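(* Let $g(s)=\frac{1}{1+G(s)}$ be the sensitivity function of a linear feedback system with open-loop (forward path) transfer function $G$. Suppose $g$ is non-analytic in the open right half plane, its zeros in the open right half plane are $\alpha_1,\dots,\alpha_M$, and its poles in the open right half plane are $\beta_1,\dots,\beta_N$. Let $$\widetilde g(s)=g(s)\prod_{1\le i\le M}\left(\frac{s+\overline{\alpha}_i}{s-\alpha_i}\right)\prod_{1\le i\le N}\left(\frac{s-\beta_i}{s+\overline{\beta}_i}\right)$$ be the modified sensitivity function, which is analytic in the open right half plane, and let $\widetilde G$ be the open-loop transfer function associated with $\widetilde g$, i.e. $\widetilde g=\frac{1}{1+\widetilde G}$. Then: (a) for every point $\sigma_k+j\eta_k$ of the open right half plane ($\sigma_k>0$, $\eta_k\in\mathbb{R}$), $$\int_{-\infty}^{\infty}\log|\widetilde g(j\omega)|\,\frac{\sigma_k}{\sigma_k^2+(\omega-\eta_k)^2}\,d\omega=\pi\log|\widetilde g(\sigma_k+j\eta_k)|;$$ (b) if $\sigma_k+j\eta_k$, $1\le k\le L$, are the zeros of $\widetilde G$ in the open right half plane, then $$\int_{-\infty}^{\infty}\log|\widetilde g(j\omega)|\,\frac{\sigma_k}{\sigma_k^2+(\omega-\eta_k)^2}\,d\omega=0,\qquad 1\le k\le L;$$ (c) if $\sigma_k+j\eta_k=\varsigma_k$, $1\le k\le S$, are the zeros of $G$ in the open right half plane, then $$\int_{-\infty}^{\infty}\log|\widetilde g(j\omega)|\,\frac{\sigma_k}{\sigma_k^2+(\omega-\eta_k)^2}\,d\omega=\pi\log|\widetilde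 g(\sigma_k+j\eta_k)|,\qquad 1\le k\le S.$$
   Context: Here $j$ is the imaginary unit, $\log$ of a positive real is the natural logarithm, and the open right half plane (RHP) is $\{s\in\mathbb{C}:\operatorname{Re}s>0\}$. The linear feedback system is a unity feedback loop with plant transfer function $G_p(s)$, controller transfer function $G_c(s)$ and open-loop (forward path) transfer function $G(s)=G_c(s)G_p(s)$. Transfer functions of the plant and controller are quotients of polynomials with real coefficients, possibly multiplied by a dead-time factor: $G(s)=\frac{Q(s)}{P(s)}e^{-t_d s}$ with real polynomials $P,Q$, $P\not\equiv0$, and $t_d\ge 0$; no restriction is placed on the relative degree. It is assumed that $1+G\not\equiv 0$, and $g=1/(1+G)$ is regarded as a meromorphic function on $\mathbb{C}$. The lists $\alpha_1,\dots,\alpha_M$ and $\beta_1,\dots,\beta_N$ are finite and complete lists of the RHP zeros and RHP poles of $g$, repeated according to multiplicity. Products and quotients such as $\widetilde g$ are taken as meromorphic functions, with removable singularities removed. With $\kappa(s)=\prod_{1\le i\le M}\frac{s+\overline{\alpha}_i}{s-\alpha_i}\prod_{1\le i\le N}\frac{s-\beta_i}{s+\overline{\beta}_i}$ one has $\widetilde g=\kappa g$ and $\widetilde G=\frac{1-\kappa+G}{\kappa}$. *)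

theory Defs
  imports "HOL-Complex_Analysis.Complex_Analysis"
begin

text \<open>
  Meromorphic functions are represented by total functions \<^typ>\<open>complex \<Rightarrow> complex\<close> whose values at
  isolated points may be arbitrary (for instance because of division by zero). All notions below
  only depend on the punctured germs of such functions. Applying \<^const>\<open>remove_sings\<close> gives
  the canonical representative, which has its removable singularities filled in
  (and the value 0 at poles).
\<close>

definition rhp :: "complex set" where
  "rhp = {s. Re s > 0}"

definition transfer_function :: "(complex \<Rightarrow> complex) \<Rightarrow> bool" where
  "transfer_function F \<longleftrightarrow>
     (\<exists>(Q :: real poly) (P :: real poly) (t :: real). P \<noteq> 0 \<and> t \<ge> 0 \<and>
        F = (\<lambda>s. poly (map_poly of_real Q) s / poly (map_poly of_real P) s * exp (- of_real t * s)))"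

text \<open>
  The limit condition says that \<open>z\<close> is a zero of the canonical representative and not a pole;
  it also holds at every point if \<open>f\<close> vanishes identically.
\<close>

definition zeros_on :: "(complex \<Rightarrow> complex) \<Rightarrow> complex set \<Rightarrow> complex set" where
  "zeros_on f A = {z \<in> A. f \<midarrow>z\<rightarrow> 0}"

definition poles_on :: "(complex \<Rightarrow> complex) \<Rightarrow> complex set \<Rightarrow> complex set" where
  "poles_on f A = {z \<in> A. is_pole f z}"

text \<open>Complete lists of zeros and of poles, repeated according to multiplicity.\<close>

definition zero_list :: "(complex \<Rightarrow> complex) \<Rightarrow> complex set \<Rightarrow> complex list \<Rightarrow> bool" where
  "zero_list f A zs \<longleftrightarrow>
     set zs = zeros_on f A \<and> (\<forall>z\<in>zeros_on f A. int (count_list zs z) = zorder f z)"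

definition pole_list :: "(complex \<Rightarrow> complex) \<Rightarrow> complex set \<Rightarrow> complex list \<Rightarrow> bool" where
  "pole_list f A ps \<longleftrightarrow>
     set ps = poles_on f A \<and> (\<forall>z\<in>poles_on f A. int (count_list ps z) = - zorder f z)"

definition sensitivity :: "(complex \<Rightarrow> complex) \<Rightarrow> complex \<Rightarrow> complex" where
  "sensitivity G = remove_sings (\<lambda>s. 1 / (1 + G s))"

definition kappa :: "complex list \<Rightarrow> complex list \<Rightarrow> complex \<Rightarrow> complex" where
  "kappa \<alpha> \<beta> s = (\<Prod>a\<leftarrow>\<alpha>. (s + cnj a) / (s - a)) * (\<Prod>b\<leftarrow>\<beta>. (s - b) / (s + cnj b))"

definition modified_sensitivity ::
    "(complex \<Rightarrow> complex) \<Rightarrow> complex list \<Rightarrow> complex list \<Rightarrow> complex \<Rightarrow> complex" where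
  "modified_sensitivity G \<alpha> \<beta> = remove_sings (\<lambda>s. kappa \<alpha> \<beta> s * sensitivity G s)"

definition modified_open_loop ::
    "(complex \<Rightarrow> complex) \<Rightarrow> complex list \<Rightarrow> complex list \<Rightarrow> complex \<Rightarrow> complex" where
  "modified_open_loop G \<alpha> \<beta> = remove_sings (\<lambda>s. (1 - kappa \<alpha> \<beta> s + G s) / kappa \<alpha> \<beta> s)"

definition poisson_integrand :: "(complex \<Rightarrow> complex) \<Rightarrow> real \<Rightarrow> real \<Rightarrow> real \<Rightarrow> real" where
  "poisson_integrand f \<sigma> \<eta> \<omega> = ln (cmod (f (\<i> * of_real \<omega>))) * (\<sigma> / (\<sigma>\<^sup>2 + (\<omega> - \<eta>)\<^sup>2))"

lemma transfer_function_meromorphic: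
  assumes "transfer_function F"
  shows "F meromorphic_on A"
proof -
  have p: "(\<lambda>s. poly p s) meromorphic_on A" for p :: "complex poly"
    by (intro analytic_on_imp_meromorphic_on analytic_on_subset[of _ UNIV A])
       (auto simp: analytic_on_open intro!: holomorphic_intros)
  have e: "(\<lambda>s. exp (- of_real t * s)) meromorphic_on A" for t
    by (intro analytic_on_imp_meromorphic_on analytic_intros)
  show ?thesis
    using assms unfolding transfer_function_def by (auto simp only: intro!: meromorphic_intros p e)
qed

lemma kappa_meromorphic: "kappa \<alpha> \<beta> meromorphic_on A"
  unfolding kappa_def [abs_def] by (intro meromorphic_intros)

lemma eventually_kappa_nonzero: "eventually (\<lambda>s. kappa \<alpha> \<beta> s \<noteq> 0) (at z)"
proof -
  let ?S = "set \<alpha> \<union> set \<beta> \<union> (\<lambda>a. - cnj a) ` (set \<alpha> \<union> set \<beta>)"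
  have "eventually (\<lambda>s. s \<notin> ?S) (at z)"
    using islimpt_finite[of ?S z] by (simp add: islimpt_iff_eventually)
  then show ?thesis
    by eventually_elim (auto simp: kappa_def prod_list_zero_iff add_eq_0_iff2)
qed

lemma zorder_pole_factor:
  assumes "Re a > 0" "Re z > 0"
  shows "zorder (\<lambda>s. (s + cnj a) / (s - a)) z = - of_bool (a = z)"
proof (cases "a = z")
  case True
  have "z + cnj z \<noteq> 0"
    using assms by (simp add: complex_eq_iff)
  then have "zorder (\<lambda>s. (s + cnj a) / (s - a)) z = -1"
    using True
    by (intro zorder_eqI[where S = UNIV and g = "\<lambda>s. s + cnj a"])
       (auto intro!: holomorphic_intros simp: power_int_minus field_simps)
  then show ?thesis using True by simp
next
  case False
  have "z + cnj a \<noteq> 0"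
    using assms by (auto simp: complex_eq_iff)
  then have "zorder (\<lambda>s. (s + cnj a) / (s - a)) z = 0"
    using False by (intro zorder_eq_0I) (auto intro!: analytic_intros)
  then show ?thesis using False by simp
qed

lemma zorder_zero_factor:
  assumes "Re a > 0" "Re z > 0"
  shows "zorder (\<lambda>s. (s - a) / (s + cnj a)) z = of_bool (a = z)"
proof -
  have "zorder (\<lambda>s. (s - a) / (s + cnj a)) z = zorder (\<lambda>s. 1 / ((s + cnj a) / (s - a))) z"
    by simp
  also have "\<dots> = zorder (\<lambda>_. 1::complex) z - zorder (\<lambda>s. (s + cnj a) / (s - a)) z"
  proof (rule zorder_divide)
    have "eventually (\<lambda>s. kappa [a] [] s \<noteq> 0) (at z)"
      by (rule eventually_kappa_nonzero)
    then show "\<exists>\<^sub>F s in at z. (s + cnj a) / (s - a) \<noteq> 0"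
      by (intro eventually_frequently) (auto simp: kappa_def)
  qed (auto intro!: meromorphic_intros)
  finally show ?thesis
    using zorder_pole_factor[OF assms] by simp
qed

lemma zorder_kappa:
  assumes "\<And>a. a \<in> set \<alpha> \<union> set \<beta> \<Longrightarrow> Re a > 0" "Re z > 0"
  shows "zorder (kappa \<alpha> \<beta>) z = int (count_list \<beta> z) - int (count_list \<alpha> z)"
  using assms
proof (induction \<alpha>)
  case Nil
  then show ?case
  proof (induction \<beta>)
    case Nil
    then show ?case by (simp add: kappa_def [abs_def])
  next
    case (Cons b \<beta>)
    have eq: "kappa [] (b # \<beta>) = (\<lambda>s. (s - b) / (s + cnj b) * kappa [] \<beta> s)"
      by (simp add: kappa_def fun_eq_iff)
    have "zorder (\<lambda>s. (s - b) / (s + cnj b) * kappa [] \<beta> s) z = zorder (\<lambda>s. (s - b) / (s + cnj b)) z + zorder (kappa [] \<beta>) z"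
    proof (rule zorder_mult)
      show "\<exists>\<^sub>F s in at z. (s - b) / (s + cnj b) \<noteq> 0"
        using eventually_kappa_nonzero[of "[]" "[b]" z]
        by (intro eventually_frequently) (auto simp: kappa_def)
    qed (auto intro!: meromorphic_intros kappa_meromorphic eventually_frequently
          eventually_kappa_nonzero)
    then show ?case
      using Cons zorder_zero_factor[of b z] by (simp add: eq)
  qed
next
  case (Cons a \<alpha>)
  have eq: "kappa (a # \<alpha>) \<beta> = (\<lambda>s. (s + cnj a) / (s - a) * kappa \<alpha> \<beta> s)"
    by (simp add: kappa_def fun_eq_iff)
  have "zorder (\<lambda>s. (s + cnj a) / (s - a) * kappa \<alpha> \<beta> s) z = zorder (\<lambda>s. (s + cnj a) / (s - a)) z + zorder (kappa \<alpha> \<beta>) z"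
  proof (rule zorder_mult)
    show "\<exists>\<^sub>F s in at z. (s + cnj a) / (s - a) \<noteq> 0"
      using eventually_kappa_nonzero[of "[a]" "[]" z]
      by (intro eventually_frequently) (auto simp: kappa_def)
  qed (auto intro!: meromorphic_intros kappa_meromorphic eventually_frequently
        eventually_kappa_nonzero)
  then show ?case
    using Cons zorder_pole_factor[of a z] by (simp add: eq)
qed

text \<open>The modified loop satisfies \<open>g~ = 1 / (1 + G~)\<close>.\<close>

lemma sensitivity_modified_open_loop:
  assumes "G meromorphic_on UNIV"
  shows "sensitivity (modified_open_loop G \<alpha> \<beta>) = modified_sensitivity G \<alpha> \<beta>"
proof
  fix z
  let ?k = "kappa \<alpha> \<beta>"
  have G: "G meromorphic_on {z}"
    using assms meromorphic_on_subset by blast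
  have "(\<lambda>s. (1 - ?k s + G s) / ?k s) meromorphic_on {z}"
    by (intro meromorphic_intros kappa_meromorphic G)
  then have 1: "eventually (\<lambda>s. modified_open_loop G \<alpha> \<beta> s = (1 - ?k s + G s) / ?k s) (at z)"
    unfolding modified_open_loop_def by (intro eventually_remove_sings_eq_at) (simp add: meromorphic_at_iff)
  have "(\<lambda>s. 1 / (1 + G s)) meromorphic_on {z}"
    by (intro meromorphic_intros G)
  then have 2: "eventually (\<lambda>s. sensitivity G s = 1 / (1 + G s)) (at z)"
    unfolding sensitivity_def by (intro eventually_remove_sings_eq_at) (simp add: meromorphic_at_iff)
  have "eventually (\<lambda>s. 1 / (1 + modified_open_loop G \<alpha> \<beta> s) = ?k s * sensitivity G s) (at z)"
    using 1 2 eventually_kappa_nonzero[of \<alpha> \<beta> z]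
  proof eventually_elim
    case (elim s)
    then have "1 + modified_open_loop G \<alpha> \<beta> s = (1 + G s) / ?k s"
      by (simp add: field_simps)
    then show ?case using elim by simp
  qed
  then show "sensitivity (modified_open_loop G \<alpha> \<beta>) z = modified_sensitivity G \<alpha> \<beta> z"
    unfolding sensitivity_def[of "modified_open_loop G \<alpha> \<beta>"] modified_sensitivity_def
    by (intro remove_sings_cong) auto
qed

text \<open>The modified sensitivity function is analytic in the open right half plane.\<close>

lemma modified_sensitivity_analytic:
  assumes G: "G meromorphic_on UNIV" and nz: "remove_sings (\<lambda>s. 1 + G s) \<noteq> (\<lambda>_. 0)"
    and zeros: "zero_list (sensitivity G) rhp \<alpha>" and poles: "pole_list (sensitivity G) rhp \<beta>"
  shows "modified_sensitivity G \<alpha> \<beta> analytic_on rhp"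
proof (subst analytic_on_analytic_at, safe)
  fix z assume z: "z \<in> rhp"
  let ?k = "kappa \<alpha> \<beta>" and ?g = "sensitivity G"
  have mer1: "(\<lambda>s. 1 + G s) meromorphic_on UNIV"
    by (intro meromorphic_intros G)
  have "(\<forall>\<^sub>\<approx>s\<in>UNIV. 1 + G s = 0) \<or> (\<forall>\<^sub>\<approx>s\<in>UNIV. 1 + G s \<noteq> 0)"
    by (rule meromorphic_imp_constant_or_avoid[OF mer1]) auto
  moreover have "remove_sings (\<lambda>s. 1 + G s) = (\<lambda>_. 0)" if "\<forall>\<^sub>\<approx>s\<in>UNIV. 1 + G s = 0"
    using that by (auto simp: eventually_cosparse_open_eq fun_eq_iff
                    intro!: remove_sings_eqI tendsto_eventually)
  ultimately have nz1: "eventually (\<lambda>s. 1 + G s \<noteq> 0) (at z)"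
    using nz by (auto simp: eventually_cosparse_open_eq)
  have "(\<lambda>s. 1 / (1 + G s)) meromorphic_on UNIV"
    by (intro meromorphic_intros G)
  then have g: "?g meromorphic_on {z}" and
    geq: "eventually (\<lambda>s. ?g s = 1 / (1 + G s)) (at z)"
    unfolding sensitivity_def
    by (auto intro!: remove_sings_meromorphic eventually_remove_sings_eq_at
             intro: meromorphic_on_subset simp: meromorphic_on_altdef)
  have gnz: "eventually (\<lambda>s. ?g s \<noteq> 0) (at z)"
    using nz1 geq by eventually_elim auto
  have kg: "(\<lambda>s. ?k s * ?g s) meromorphic_on {z}"
    by (intro meromorphic_intros kappa_meromorphic g)
  have kgnz: "eventually (\<lambda>s. ?k s * ?g s \<noteq> 0) (at z)"
    using gnz eventually_kappa_nonzero[of \<alpha> \<beta> z] by eventually_elim auto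
  have "zorder ?g z = int (count_list \<alpha> z) - int (count_list \<beta> z)"
  proof -
    consider "z \<in> poles_on ?g rhp" | "z \<in> zeros_on ?g rhp"
      | "\<not> is_pole ?g z" "\<not> isolated_zero ?g z" "z \<notin> zeros_on ?g rhp" "z \<notin> poles_on ?g rhp"
      using z by (auto simp: zeros_on_def poles_on_def isolated_zero_def)
    then show ?thesis
    proof cases
      case 1
      then have "z \<notin> zeros_on ?g rhp"
        using not_tendsto_and_filterlim_at_infinity[of "at z" ?g 0]
        by (auto simp: zeros_on_def poles_on_def is_pole_def)
      then have "count_list \<alpha> z = 0"
        using zeros by (auto simp: zero_list_def count_list_0_iff)
      then show ?thesis
        using 1 poles by (simp add: pole_list_def)
    next
      case 2
      then have "z \<notin> poles_on ?g rhp"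
        using not_tendsto_and_filterlim_at_infinity[of "at z" ?g 0]
        by (auto simp: zeros_on_def poles_on_def is_pole_def)
      then have "count_list \<beta> z = 0"
        using poles by (auto simp: pole_list_def count_list_0_iff)
      then show ?thesis
        using 2 zeros by (simp add: zero_list_def)
    next
      case 3
      then have "count_list \<alpha> z = 0" "count_list \<beta> z = 0"
        using zeros poles by (auto simp: zero_list_def pole_list_def count_list_0_iff)
      moreover have "zorder ?g z = 0"
        using not_pole_not_isolated_zero_imp_zorder_eq_0[OF g 3(1,2)] gnz
        by (simp add: eventually_frequently)
      ultimately show ?thesis by simp
    qed
  qed
  moreover have "zorder ?k z = int (count_list \<beta> z) - int (count_list \<alpha> z)"
    using z zeros poles
    by (intro zorder_kappa)
       (auto simp: zero_list_def pole_list_def zeros_on_def poles_on_def rhp_def)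
  moreover have "zorder (\<lambda>s. ?k s * ?g s) z = zorder ?k z + zorder ?g z"
    by (intro zorder_mult kappa_meromorphic g eventually_frequently gnz eventually_kappa_nonzero) auto
  ultimately have "zorder (\<lambda>s. ?k s * ?g s) z = 0"
    by simp
  then have "\<not> is_pole (\<lambda>s. ?k s * ?g s) z"
    using isolated_pole_imp_neg_zorder[of "\<lambda>s. ?k s * ?g s" z] kg by (auto simp: meromorphic_at_iff)
  then show "modified_sensitivity G \<alpha> \<beta> analytic_on {z}"
    using kg unfolding modified_sensitivity_def meromorphic_at_iff not_essential_def
    by (auto intro: remove_sings_analytic_at)
qed

end

theory Submission
  imports Defs
begin

text \<open>
  With \<open>G = Q/P e\<^sup>-\<^sup>t\<^sup>s\<close>, the modified sensitivity function is, in the closed right half plane, a quotient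
  \<open>f2 / f1\<close> of bounded analytic functions without zeros in the open half plane: reflect the right
  half plane roots of \<open>P\<close>, divide \<open>P\<close> and \<open>P + Q e\<^sup>-\<^sup>t\<^sup>s\<close> by a power of \<open>s + 1\<close>, and put the
  remaining Blaschke factors into \<open>f1\<close>. Both functions decay at most polynomially towards
  \<open>+\<infinity>\<close>, because \<open>P + Q e\<^sup>-\<^sup>t\<^sup>s\<close> is a
  polynomial or is dominated by \<open>P\<close> there.

  It remains to prove the Poisson formula for \<open>ln |f|\<close> when \<open>f\<close> is such a function, even though \<open>f\<close> may have
  infinitely many zeros on the imaginary axis. A Moebius map moves the problem to the unit disc, where
  the only singular boundary point is \<open>1\<close> and the claim is the mean value property of \<open>U = - ln |F| \<ge> 0\<close>.
  One inequality is Fatou's lemma on the circles of radius \<open>r < 1\<close>. For the other one, \<open>U (r z)\<close> exceeds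
  \<open>U z\<close> by at most \<open>e\<close> on any compact arc avoiding \<open>1\<close>, for \<open>r\<close> close to \<open>1\<close>. The mass of \<open>U (r z)\<close> near \<open>1\<close> is at most
  \<open>2 (1 - \<rho>) U (r \<rho>)\<close> by the Poisson formula at \<open>r \<rho>\<close>, because the Poisson kernel at \<open>\<rho>\<close> is at least
  \<open>1 / (2 (1 - \<rho>))\<close> there, and \<open>(1 - \<rho>) U \<rho>\<close> is arbitrarily small by the growth condition.
\<close>

subsection \<open>Radial behaviour near the unit circle\<close>

text \<open>Cauchy's formula at \<open>w\<close> is applied to \<open>L\<close> times a factor that
  equals 1 at \<open>w\<close> and converts the Cauchy kernel into the Poisson kernel on the unit
  circle.\<close>

lemma poisson_integral_circle:
  assumes L: "L holomorphic_on ball 0 R" and R: "R > 1" and w: "cmod w < 1"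
  shows "((\<lambda>t. of_real ((1 - (cmod w)\<^sup>2) / (cmod (cis (2 * pi * t) - w))\<^sup>2) * L (cis (2 * pi * t)))
           has_integral L w) {0..1}"
proof -
  \<comment> \<open>The denominator vanishes only at the mirror image of \<open>w\<close> in the
    unit circle, so \<open>H\<close> is holomorphic on the closed disc.\<close>
  define H where "H = (\<lambda>z. L z * (1 - (cmod w)\<^sup>2) / (1 - cnj w * z))"
  have nz: "1 - cnj w * z \<noteq> 0" if "cmod z \<le> 1" for z
  proof
    assume "1 - cnj w * z = 0"
    then have "cnj w * z = 1" by simp
    then have "cmod w * cmod z = 1"
      by (metis complex_mod_cnj norm_mult norm_one)
    moreover have "cmod w * cmod z \<le> cmod w * 1"
      using that by (intro mult_left_mono) auto
    ultimately show False using w by simp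
  qed
  have "L holomorphic_on cball 0 1"
    using R by (intro holomorphic_on_subset[OF L]) auto
  then have "H holomorphic_on cball 0 1"
    unfolding H_def using nz by (intro holomorphic_intros) auto
  then have "((\<lambda>u. H u / (u - w)) has_contour_integral (2 * of_real pi * \<i> * H w)) (circlepath 0 1)"
    using w by (intro Cauchy_integral_circlepath_simple) auto
  then have I: "((\<lambda>t. H (circlepath 0 1 t) / (circlepath 0 1 t - w) *
       vector_derivative (circlepath 0 1) (at t within {0..1})) has_integral
       (2 * of_real pi * \<i> * H w)) {0..1}"
    by (simp add: has_contour_integral_def)
  have "1 - cnj w * w \<noteq> 0" using nz[of w] w by simp
  moreover have "cnj w * w = of_real ((cmod w)\<^sup>2)"
    by (simp add: complex_norm_square mult.commute del: of_real_power)
  ultimately have Hw: "H w = L w"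
    by (simp add: H_def)
  have "((\<lambda>t. 2 * of_real pi * \<i> * (of_real ((1 - (cmod w)\<^sup>2) / (cmod (cis (2 * pi * t) - w))\<^sup>2) * L (cis (2 * pi * t))))
           has_integral 2 * of_real pi * \<i> * L w) {0..1}"
  proof (rule has_integral_eq[OF _ I[unfolded Hw]])
    fix t :: real assume t: "t \<in> {0..1}"
    define z where "z = cis (2 * pi * t)"
    have cz: "circlepath 0 1 t = z"
      by (simp add: circlepath z_def cis_conv_exp mult_ac)
    have d: "vector_derivative (circlepath 0 1) (at t within {0..1}) = 2 * pi * \<i> * z"
      using t by (simp add: vector_derivative_circlepath01 z_def cis_conv_exp mult_ac)
    have z1: "cmod z = 1" by (simp add: z_def)
    then have zz: "z * cnj z = 1" by (simp add: complex_norm_square[symmetric])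
    have "z \<noteq> w" "z \<noteq> 0" using w z1 by auto
    have nz': "1 - cnj w * z \<noteq> 0" using z1 nz by simp
    \<comment> \<open>On the circle \<open>z * cnj z = 1\<close>, hence
      \<open>1 - cnj w * z = z * cnj (z - w)\<close>. This produces the squared distance of the
      Poisson kernel, and the remaining \<open>z\<close> cancels against the derivative of the
      path.\<close>
    have "(1 - cnj w * z) * (z - w) = z * ((z - w) * cnj (z - w))"
      using zz by (simp add: algebra_simps)
    also have "(z - w) * cnj (z - w) = of_real ((cmod (z - w))\<^sup>2)"
      by (rule complex_norm_square[symmetric])
    finally have key: "(1 - cnj w * z) * (z - w) = z * of_real ((cmod (z - w))\<^sup>2)" .
    have E: "H z / (z - w) * z = of_real ((1 - (cmod w)\<^sup>2) / (cmod (z - w))\<^sup>2) * L z"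
    proof -
      have "H z / (z - w) * z = L z * (1 - (cmod w)\<^sup>2) * z / ((1 - cnj w * z) * (z - w))"
        by (simp add: H_def)
      also have "\<dots> = of_real ((1 - (cmod w)\<^sup>2) / (cmod (z - w))\<^sup>2) * L z"
        using \<open>z \<noteq> 0\<close> \<open>z \<noteq> w\<close> unfolding key by (simp add: field_simps)
      finally show ?thesis .
    qed
    show "H (circlepath 0 1 t) / (circlepath 0 1 t - w) *
        vector_derivative (circlepath 0 1) (at t within {0..1}) =
        2 * of_real pi * \<i> * (of_real ((1 - (cmod w)\<^sup>2) / (cmod (cis (2 * pi * t) - w))\<^sup>2) * L (cis (2 * pi * t)))"
      unfolding cz d z_def[symmetric] E[symmetric] by simp
  qed
  from has_integral_mult_right[OF this, of "1 / (2 * of_real pi * \<i>)"] show ?thesis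
    by simp
qed

text \<open>With \<open>c\<close> the cosine of the angle between \<open>z\<close> and
  \<open>a\<close>, the difference of the squares is \<open>(1 - r)\<^sup>2 * (1 + c) / 2\<close>.
  The point is that the constant tends to 1 as \<open>r\<close> does, uniformly in \<open>z\<close>,
  so a boundary zero at \<open>a\<close> costs almost nothing when moving inwards.\<close>

lemma norm_radial_diff_ge:
  fixes a z :: complex
  assumes "cmod a = 1" "cmod z = 1" "0 \<le> r" "r \<le> 1"
  shows "(1 + r) / 2 * cmod (z - a) \<le> cmod (of_real r * z - a)"
proof (rule power2_le_imp_le)
  define c where "c = z \<bullet> a"
  have n: "z \<bullet> z = 1" "a \<bullet> a = 1" using assms by (simp_all add: dot_square_norm)
  have c: "-1 \<le> c" using Cauchy_Schwarz_ineq2[of z a] assms by (simp add: c_def)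
  have 1: "(cmod (z - a))\<^sup>2 = 2 - 2 * c"
    using n by (simp add: power2_norm_eq_inner inner_diff inner_commute c_def)
  have "of_real r * z = r *\<^sub>R z" by (simp add: scaleR_conv_of_real)
  then have 2: "(cmod (of_real r * z - a))\<^sup>2 = r\<^sup>2 + 1 - 2 * r * c"
    using n by (simp add: power2_norm_eq_inner inner_diff inner_commute c_def)
      (simp add: power2_eq_square)
  have "(cmod (of_real r * z - a))\<^sup>2 - ((1 + r) / 2 * cmod (z - a))\<^sup>2 = (1 - r)\<^sup>2 * (1 + c) / 2"
    unfolding power_mult_distrib 1 2 by (simp add: power2_eq_square field_simps)
  moreover have "\<dots> \<ge> 0" using c by simp
  ultimately show "((1 + r) / 2 * cmod (z - a))\<^sup>2 \<le> (cmod (of_real r * z - a))\<^sup>2" by linarith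
qed simp

text \<open>Split off the zero at \<open>a\<close>: \<open>F w = H w * (w - a) ^ n\<close> with
  \<open>H a \<noteq> 0\<close>. The power is controlled by \<open>norm_radial_diff_ge\<close> and
  \<open>H\<close> by continuity. Radius and boundary point vary jointly, so that compactness can
  make the bound uniform afterwards.\<close>

lemma radial_lower_bound_at:
  assumes an: "F analytic_on {a}" and a: "cmod a = 1" and nz: "\<exists>\<^sub>F z in at a. F z \<noteq> 0"
    and q: "q < 1"
  shows "\<forall>\<^sub>F p in nhds (1, a). cmod (snd p) = 1 \<and> fst p \<le> 1 \<longrightarrow>
           q * cmod (F (snd p)) \<le> cmod (F (of_real (fst p) * snd p))"
proof -
  from an obtain e where e: "e > 0" "F holomorphic_on ball a e"
    by (auto simp: analytic_on_def)
  have "\<exists>z\<in>ball a e. F z \<noteq> 0"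
    using frequently_eventually_conj[OF nz eventually_at_ball[OF e(1)]] frequently_ex by blast
  from zorder_exist_zero[OF e(2) open_ball connected_ball _ this] e(1)
  obtain r H where r: "r > 0" "H holomorphic_on cball a r" 
      and eq: "\<And>w. w \<in> cball a r \<Longrightarrow> F w = H w * (w - a) ^ nat (zorder F a) \<and> H w \<noteq> 0"
    by (metis centre_in_ball)
  define n where "n = nat (zorder F a)"
  have cH: "continuous (at a) H"
    using r by (meson centre_in_ball continuous_on_eq_continuous_at holomorphic_on_imp_continuous_on
        holomorphic_on_subset open_ball ball_subset_cball)
  have Ha: "H a \<noteq> 0" using eq r by simp
  \<comment> \<open>The inequality after cancelling the common power of
    \<open>cmod (snd p - a)\<close>; the limit \<open>(1 - q) * cmod (H a)\<close> is
    positive.\<close>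
  let ?D = "\<lambda>p::real \<times> complex. ((1 + fst p) / 2) ^ n * cmod (H (of_real (fst p) * snd p)) - q * cmod (H (snd p))"
  let ?N = "nhds (1::real, a)"
  have f: "(fst \<longlongrightarrow> 1) ?N" and s: "(snd \<longlongrightarrow> a) ?N"
    by (auto intro: tendsto_eq_intros filterlim_ident)
  have fs: "((\<lambda>p. of_real (fst p) * snd p) \<longlongrightarrow> a) ?N"
    using tendsto_mult[OF tendsto_of_real[OF f] s] by simp
  have "((\<lambda>p. H (snd p)) \<longlongrightarrow> H a) ?N" "((\<lambda>p. H (of_real (fst p) * snd p)) \<longlongrightarrow> H a) ?N"
    by (rule isCont_tendsto_compose[OF cH] s fs)+
  then have "(?D \<longlongrightarrow> ((1 + 1) / 2) ^ n * cmod (H a) - q * cmod (H a)) ?N"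
    by (intro tendsto_intros f) simp_all
  moreover have "((1 + 1) / 2) ^ n * cmod (H a) - q * cmod (H a) > 0"
    using q Ha by simp
  ultimately have "\<forall>\<^sub>F p in ?N. ?D p > 0"
    by (rule order_tendstoD)
  moreover have "\<forall>\<^sub>F p in ?N. snd p \<in> ball a r" "\<forall>\<^sub>F p in ?N. of_real (fst p) * snd p \<in> ball a r"
    by (rule topological_tendstoD[OF s] topological_tendstoD[OF fs]; use r in simp)+
  moreover have "\<forall>\<^sub>F p in ?N. fst p > 0"
    by (rule order_tendstoD[OF f]) simp
  ultimately show ?thesis
  proof eventually_elim
    case (elim p)
    show ?case
    proof
      assume p: "cmod (snd p) = 1 \<and> fst p \<le> 1"
      let ?r = "fst p" and ?z = "snd p"
      have "q * cmod (F ?z) = (q * cmod (H ?z)) * cmod (?z - a) ^ n"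
        using eq[of ?z] elim by (simp add: norm_mult norm_power n_def)
      also have "\<dots> \<le> ((1 + ?r) / 2) ^ n * cmod (H (of_real ?r * ?z)) * cmod (?z - a) ^ n"
        using elim by (intro mult_right_mono) auto
      also have "\<dots> = ((1 + ?r) / 2 * cmod (?z - a)) ^ n * cmod (H (of_real ?r * ?z))"
        by (simp add: power_mult_distrib mult_ac power_divide)
      also have "\<dots> \<le> cmod (of_real ?r * ?z - a) ^ n * cmod (H (of_real ?r * ?z))"
        using p elim a by (intro mult_right_mono power_mono norm_radial_diff_ge) auto
      also have "\<dots> = cmod (F (of_real ?r * ?z))"
        using eq[of "of_real ?r * ?z"] elim by (simp add: norm_mult norm_power n_def)
      finally show "q * cmod (F ?z) \<le> cmod (F (of_real ?r * ?z))" .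
    qed
  qed
qed

text \<open>The local bounds hold on a neighbourhood of the slice where the radius is 1 and the
  point runs through \<open>K\<close>; the tube lemma yields one range of radii for all of
  \<open>K\<close>.\<close>

lemma radial_lower_bound:
  assumes K: "compact K" "K \<subseteq> sphere 0 1" and an: "F analytic_on K"
    and nz: "\<And>a. a \<in> K \<Longrightarrow> \<exists>\<^sub>F z in at a. F z \<noteq> 0" and q: "q < 1"
  shows "\<forall>\<^sub>F r in at_left 1. \<forall>z\<in>K. q * cmod (F z) \<le> cmod (F (of_real r * z))"
proof (cases "K = {}")
  case False
  define G where "G = {p :: real \<times> complex. cmod (snd p) = 1 \<and> fst p \<le> 1 \<longrightarrow>
           q * cmod (F (snd p)) \<le> cmod (F (of_real (fst p) * snd p))}"
  have "(1, a) \<in> interior G" if "a \<in> K" for a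
  proof -
    have "F analytic_on {a}" "cmod a = 1"
      using that an K(2) by (auto intro: analytic_on_subset)
    from radial_lower_bound_at[OF this nz[OF that] q] have "\<forall>\<^sub>F p in nhds (1, a). p \<in> G"
      unfolding G_def by simp
    then show ?thesis
      by (meson eventually_nhds interiorI subsetI)
  qed
  \<comment> \<open>The coordinates are swapped because the tube lemma expects the compact factor
    first.\<close>
  then have sub: "(\<lambda>x. (x, 1)) ` K \<subseteq> (\<lambda>p. (snd p, fst p)) -` interior G"
    by auto
  have "open ((\<lambda>p. (snd p, fst p)) -` interior G :: (complex \<times> real) set)"
    by (intro open_vimage continuous_intros) auto
  then have "openin (top_of_set (K \<times> UNIV)) ((K \<times> UNIV) \<inter> (\<lambda>p. (snd p, fst p)) -` interior G)"
    by auto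
  from tube_lemma[OF K(1) False _ this, of 1] sub
  obtain V :: "real set" where V: "openin (top_of_set UNIV) V" "1 \<in> V"
      "K \<times> V \<subseteq> (K \<times> UNIV) \<inter> (\<lambda>p. (snd p, fst p)) -` interior G"
    by blast
  then have "open V" by simp
  then have "\<forall>\<^sub>F r in at_left 1. r \<in> V"
    using V(2) eventually_at_topological by blast
  moreover have "\<forall>\<^sub>F r in at_left 1. r < (1::real)"
    by (simp add: eventually_at_filter)
  ultimately show ?thesis
  proof eventually_elim
    case (elim r)
    show ?case
    proof
      fix z assume "z \<in> K"
      then have "(r, z) \<in> G" using V(3) elim interior_subset by fastforce
      then show "q * cmod (F z) \<le> cmod (F (of_real r * z))"
        using elim K(2) \<open>z \<in> K\<close> by (auto simp: G_def)
    qed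
  qed
qed simp

subsection \<open>The mean value property with a singular boundary point\<close>

lemma cis_neq_1:
  assumes "0 < t" "t < 1"
  shows "cis (2 * pi * t) \<noteq> 1"
proof
  assume "cis (2 * pi * t) = 1"
  then have "cos (2 * pi * t) = 1" by (simp add: complex_eq_iff)
  then obtain n :: int where "2 * pi * t = of_int n * (2 * pi)"
    by (auto simp: cos_one_2pi_int)
  then have "t = of_int n" by simp
  then show False using assms by simp
qed

lemma inj_on_cis_2pi: "inj_on (\<lambda>t. cis (2 * pi * t)) {0<..<1}"
proof (rule inj_onI)
  fix x y :: real
  assume xy: "x \<in> {0<..<1}" "y \<in> {0<..<1}" "cis (2 * pi * x) = cis (2 * pi * y)"
  have *: False if "s < t" "s \<in> {0<..<1}" "t \<in> {0<..<1}" "cis (2 * pi * s) = cis (2 * pi * t)" for s t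
  proof -
    have "cis (2 * pi * (t - s)) = cis (2 * pi * t) / cis (2 * pi * s)"
      by (simp add: cis_divide right_diff_distrib)
    then have "cis (2 * pi * (t - s)) = 1" using that(4) by simp
    then show False using cis_neq_1[of "t - s"] that by auto
  qed
  show "x = y" using *[of x y] *[of y x] xy by (metis linorder_neqE)
qed

context
  fixes F :: "complex \<Rightarrow> complex"
  assumes an: "F analytic_on (cball 0 1 - {1})"
    and bd: "\<And>z. z \<in> cball 0 1 - {1} \<Longrightarrow> cmod (F z) \<le> 1"
    and nz: "\<And>z. cmod z < 1 \<Longrightarrow> F z \<noteq> 0"
begin

private lemma log_nonpos: "z \<in> cball 0 1 - {1} \<Longrightarrow> ln (cmod (F z)) \<le> 0"
  using bd[of z] by (cases "F z = 0") auto

private lemma scaled_in: "0 \<le> r \<Longrightarrow> r < 1 \<Longrightarrow> cmod (of_real r * cis x) < 1"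
  by (simp add: norm_mult)

text \<open>A function without zeros on the disc has a holomorphic logarithm \<open>g\<close>, and
  \<open>ln (cmod (F z)) = Re (g z)\<close>. Rescaling by \<open>r < 1\<close> makes
  \<open>g\<close> holomorphic on the larger disc of radius \<open>1 / r\<close>, so the Poisson
  formula applies to it.\<close>

private lemma poisson_scaled:
  assumes r: "0 < r" "r < 1" and w: "cmod w < 1"
  shows "((\<lambda>t. (1 - (cmod w)\<^sup>2) / (cmod (cis (2 * pi * t) - w))\<^sup>2 * ln (cmod (F (of_real r * cis (2 * pi * t)))))
           has_integral ln (cmod (F (of_real r * w)))) {0..1}"
proof -
  have "F holomorphic_on ball 0 1"
    by (rule analytic_imp_holomorphic, rule analytic_on_subset[OF an]) auto
  then obtain g where g: "g holomorphic_on ball 0 1" "\<And>z. z \<in> ball 0 1 \<Longrightarrow> F z = exp (g z)"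
    using contractible_imp_holomorphic_log[of F "ball 0 1"] nz convex_imp_contractible[OF convex_ball]
    by (metis mem_ball_0)
  have lng: "ln (cmod (F z)) = Re (g z)" if "cmod z < 1" for z
    using g(2)[of z] that by simp
  have "(g \<circ> (\<lambda>z. of_real r * z)) holomorphic_on ball 0 (1 / r)"
    using r by (intro holomorphic_on_compose_gen[OF _ g(1)] holomorphic_intros)
      (auto simp: norm_mult field_simps)
  note lin = has_integral_linear[OF poisson_integral_circle[OF this _ w] bounded_linear_Re]
  define k where "k t = (1 - (cmod w)\<^sup>2) / (cmod (cis (2 * pi * t) - w))\<^sup>2" for t
  have "((\<lambda>t. k t * Re (g (of_real r * cis (2 * pi * t)))) has_integral Re (g (of_real r * w))) {0..1}"
    using lin r unfolding o_def k_def[symmetric] by simp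
  moreover have "cmod (of_real r * w) < 1"
    using mult_strict_mono'[of r 1 "cmod w" 1] r w by (simp add: norm_mult)
  ultimately show ?thesis
    using lng scaled_in[of r] r by (simp add: k_def)
qed

text \<open>Every boundary point is a limit of points of the open disc, where \<open>F\<close> has
  no zeros. This guarantees a finite order of vanishing at the boundary.\<close>

private lemma frequently_nonzero:
  assumes "cmod a = 1"
  shows "\<exists>\<^sub>F z in at a. F z \<noteq> 0"
proof -
  have "a islimpt ball 0 1" using assms by (simp add: islimpt_ball)
  then have "\<exists>\<^sub>F z in at a. z \<in> ball 0 1" by (simp add: islimpt_conv_frequently_at)
  then show ?thesis by (rule frequently_mono[rotated]) (simp add: nz)
qed

private lemma cis_in:
  assumes "t \<in> {0<..<1}"
  shows "cis (2 * pi * t) \<in> cball 0 1 - {1}"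
  using assms cis_neq_1[of t] by auto

private lemma cont_boundary: "continuous_on {0<..<1} (\<lambda>t. F (cis (2 * pi * t)))"
proof -
  have "continuous_on (cball 0 1 - {1}) F"
    by (intro holomorphic_on_imp_continuous_on analytic_imp_holomorphic an)
  from continuous_on_compose2[OF this, of "{0<..<1}" "\<lambda>t. cis (2 * pi * t)"] show ?thesis
    using cis_in by (force intro: continuous_intros)
qed

text \<open>Fatou's lemma for the nonnegative functions \<open>- ln (cmod F)\<close> on circles of
  radius tending to 1, whose integrals all equal the value at 0. The bound on the limit gives
  integrability as well.\<close>

private lemma boundary_integral_ge:
  "(\<lambda>t. ln (cmod (F (cis (2 * pi * t))))) absolutely_integrable_on {0<..<1}"
  "ln (cmod (F 0)) \<le> integral {0<..<1} (\<lambda>t. ln (cmod (F (cis (2 * pi * t)))))"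
proof -
  let ?u = "\<lambda>t. - ln (cmod (F (cis (2 * pi * t))))"
  \<comment> \<open>The shift by 2 keeps the radius strictly between 0 and 1 already for
    \<open>n = 0\<close>.\<close>
  define \<rho> where "\<rho> n = 1 - 1 / real (n + 2)" for n
  have \<rho>: "0 < \<rho> n" "\<rho> n < 1" for n by (auto simp: \<rho>_def field_simps)
  have "(\<lambda>n. 1 - 1 / real (n + 2)) \<longlonglongrightarrow> 1 - 0"
    by (intro tendsto_intros LIMSEQ_ignore_initial_segment[OF lim_inverse_n', of 2])
  then have \<rho>1: "\<rho> \<longlonglongrightarrow> 1" by (simp add: \<rho>_def[abs_def])
  define v where "v n t = - ln (cmod (F (of_real (\<rho> n) * cis (2 * pi * t))))" for n t
  have vint: "(v n has_integral - ln (cmod (F 0))) {0..1}" for n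
    using has_integral_neg[OF poisson_scaled[OF \<rho>(1,2)[of n], of 0]] by (simp add: v_def[abs_def])
  have v0: "v n t \<ge> 0" for n t
    using log_nonpos[of "of_real (\<rho> n) * cis (2 * pi * t)"] scaled_in[of "\<rho> n" "2 * pi * t"] \<rho>[of n]
    by (force simp: v_def)
  have cF: "continuous_on (ball 0 1) F"
    by (intro holomorphic_on_imp_continuous_on analytic_imp_holomorphic analytic_on_subset[OF an]) auto
  have vcont: "continuous_on UNIV (v n)" for n
  proof -
    have "continuous_on UNIV (\<lambda>t. F (of_real (\<rho> n) * cis (2 * pi * t)))"
      using scaled_in[of "\<rho> n"] \<rho>[of n]
      by (intro continuous_on_compose2[OF cF] continuous_intros) (auto simp: less_imp_le)
    then show ?thesis
      unfolding v_def[abs_def] using scaled_in[of "\<rho> n"] \<rho>[of n]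
      by (intro continuous_intros) (auto intro!: nz simp: less_imp_le)
  qed
  have nnv: "(\<integral>\<^sup>+t. ennreal (indicator {0<..<1} t * v n t) \<partial>lborel) \<le> ennreal (- ln (cmod (F 0)))" for n
  proof -
    have "(\<integral>\<^sup>+t. ennreal (indicator {0<..<1} t * v n t) \<partial>lborel)
        \<le> (\<integral>\<^sup>+t. ennreal (indicator {0..1} t * v n t) \<partial>lborel)"
      using v0 by (intro nn_integral_mono) (auto simp: indicator_def)
    also have "\<dots> = ennreal (- ln (cmod (F 0)))"
      by (rule nn_integral_has_integral_lebesgue[OF _ vint]) (rule v0)
    finally show ?thesis .
  qed
  have meas: "(\<lambda>t. indicator {0<..<1} t * ?u t) \<in> borel_measurable borel"
  proof -
    have "(\<lambda>t. indicator {0<..<1} t *\<^sub>R F (cis (2 * pi * t))) \<in> borel_measurable borel"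
      by (rule borel_measurable_continuous_on_indicator[OF _ cont_boundary]) auto
    then have "(\<lambda>t. - ln (cmod (indicator {0<..<1} t *\<^sub>R F (cis (2 * pi * t))))) \<in> borel_measurable borel"
      by measurable
    \<comment> \<open>The indicator may be pulled out of the logarithm because
      \<open>ln 0 = 0\<close>.\<close>
    moreover have "(\<lambda>t. - ln (cmod (indicator {0<..<1} t *\<^sub>R F (cis (2 * pi * t))))) =
        (\<lambda>t. indicator {0<..<1} t * ?u t)"
      by (auto simp: fun_eq_iff indicator_def)
    ultimately show ?thesis by (simp only:)
  qed
  have pt: "ennreal (indicator {0<..<1} t * ?u t) \<le> liminf (\<lambda>n. ennreal (indicator {0<..<1} t * v n t))" for t
  proof (cases "t \<in> {0<..<1} \<and> F (cis (2 * pi * t)) \<noteq> 0")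
    case True
    let ?z = "cis (2 * pi * t)"
    have "F analytic_on {?z}" using True cis_in[of t] by (intro analytic_on_subset[OF an]) auto
    then have "isCont F ?z" by (rule analytic_at_imp_isCont)
    moreover have "(\<lambda>n. of_real (\<rho> n) * ?z) \<longlonglongrightarrow> of_real 1 * ?z"
      by (intro tendsto_intros \<rho>1)
    ultimately have "(\<lambda>n. F (of_real (\<rho> n) * ?z)) \<longlonglongrightarrow> F ?z"
      using isCont_tendsto_compose[of ?z F] by simp
    then have "(\<lambda>n. v n t) \<longlonglongrightarrow> ?u t"
      unfolding v_def using True by (intro tendsto_intros) auto
    then have "(\<lambda>n. ennreal (indicator {0<..<1} t * v n t)) \<longlonglongrightarrow> ennreal (indicator {0<..<1} t * ?u t)"
      by (intro tendsto_intros)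
    then show ?thesis by (simp add: lim_imp_Liminf)
  next
    \<comment> \<open>At a boundary zero of \<open>F\<close> the convention \<open>ln 0 = 0\<close>
      makes the left-hand side 0, just as outside the interval.\<close>
    case False
    then have "indicator {0<..<1} t * ?u t = 0" by auto
    then have "ennreal (indicator {0<..<1} t * ?u t) = 0" by (simp only: ennreal_0)
    then show ?thesis by (simp only: zero_le)
  qed
  have "(\<integral>\<^sup>+t. ennreal (indicator {0<..<1} t * ?u t) \<partial>lborel)
      \<le> (\<integral>\<^sup>+t. liminf (\<lambda>n. ennreal (indicator {0<..<1} t * v n t)) \<partial>lborel)"
    by (intro nn_integral_mono pt)
  also have "\<dots> \<le> liminf (\<lambda>n. \<integral>\<^sup>+t. ennreal (indicator {0<..<1} t * v n t) \<partial>lborel)"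
    using borel_measurable_continuous_onI[OF vcont] by (intro nn_integral_liminf) measurable
  also have "\<dots> \<le> ennreal (- ln (cmod (F 0)))"
    by (intro Liminf_le always_eventually allI nnv) auto
  finally have fin: "(\<integral>\<^sup>+t. ennreal (indicator {0<..<1} t * ?u t) \<partial>lborel) \<le> ennreal (- ln (cmod (F 0)))" .
  have nonneg: "0 \<le> indicator {0<..<1} t * ?u t" for t
    using log_nonpos[OF cis_in[of t]] by (auto simp: indicator_def)
  have int: "integrable lborel (\<lambda>t. indicator {0<..<1} t * ?u t)"
  proof (rule integrableI_nonneg)
    show "AE t in lborel. 0 \<le> indicator {0<..<1} t * ?u t"
      using nonneg by simp
    show "(\<integral>\<^sup>+t. ennreal (indicator {0<..<1} t * ?u t) \<partial>lborel) < \<infinity>"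
      using fin by (rule le_less_trans) simp
  qed (use meas in simp)
  \<comment> \<open>Absolute integrability refers to the completed measure, so Borel measurability
    is used to pass from \<open>lborel\<close> to its completion.\<close>
  then have "integrable lebesgue (\<lambda>t. indicator {0<..<1} t * ?u t)"
    using meas by (subst integrable_completion) auto
  then have abs: "?u absolutely_integrable_on {0<..<1}"
    by (simp add: set_integrable_def)
  then show "(\<lambda>t. ln (cmod (F (cis (2 * pi * t))))) absolutely_integrable_on {0<..<1}"
    unfolding set_integrable_def by auto
  have "ennreal (integral\<^sup>L lborel (\<lambda>t. indicator {0<..<1} t * ?u t)) \<le> ennreal (- ln (cmod (F 0)))"
    using nn_integral_eq_integral[OF int] nonneg fin by simp
  then have "integral\<^sup>L lborel (\<lambda>t. indicator {0<..<1} t * ?u t) \<le> - ln (cmod (F 0))"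
    using log_nonpos[of 0] by (subst (asm) ennreal_le_iff) auto
  also have "integral\<^sup>L lborel (\<lambda>t. indicator {0<..<1} t * ?u t) = integral {0<..<1} ?u"
    using set_lebesgue_integral_eq_integral(2)[OF abs] integral_completion[of "\<lambda>t. indicator {0<..<1} t * ?u t" lborel] meas
    by (simp add: set_lebesgue_integral_def)
  finally show "ln (cmod (F 0)) \<le> integral {0<..<1} (\<lambda>t. ln (cmod (F (cis (2 * pi * t)))))"
    by simp
qed

text \<open>For one radius \<open>r\<close> close to 1 the integrand \<open>v\<close> is dominated
  by \<open>?u + e\<close> on an arc away from 1, and near 1 by a multiple of the Poisson kernel at
  \<open>\<rho>\<close> times \<open>v\<close>, whose integral is known exactly.\<close>

private lemma boundary_integral_le:
  assumes small: "\<And>e. e > 0 \<Longrightarrow> \<exists>\<rho>. 0 < \<rho> \<and> \<rho> < 1 \<and> (1 - \<rho>) * - ln (cmod (F (of_real \<rho>))) < e"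
  shows "- ln (cmod (F 0)) \<le> integral {0<..<1} (\<lambda>t. - ln (cmod (F (cis (2 * pi * t)))))"
proof (rule field_le_epsilon)
  let ?u = "\<lambda>t. - ln (cmod (F (cis (2 * pi * t))))"
  fix e' :: real assume "e' > 0"
  \<comment> \<open>One third is spent on the arc \<open>T\<close>, two thirds on the part near 1,
    where the factor 2 appears.\<close>
  define e where "e = e' / 3"
  have e: "e > 0" using \<open>e' > 0\<close> by (simp add: e_def)
  from small[OF e] obtain \<rho> where \<rho>: "0 < \<rho>" "\<rho> < 1" "(1 - \<rho>) * - ln (cmod (F (of_real \<rho>))) < e"
    by auto
  \<comment> \<open>The denominator of the Poisson kernel at \<open>\<rho>\<close>. At
    \<open>t = 0\<close> it is \<open>(1 - \<rho>)\<^sup>2\<close>, so by continuity it stays below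
    twice that near the singular point.\<close>
  define D where "D t = (cmod (cis (2 * pi * t) - of_real \<rho>))\<^sup>2" for t
  have "continuous_on UNIV D" unfolding D_def[abs_def] by (intro continuous_intros)
  then have "isCont D 0" by (simp add: continuous_on_eq_continuous_at)
  moreover have "D 0 < 2 * (1 - \<rho>)\<^sup>2"
  proof -
    have "D 0 = (1 - \<rho>)\<^sup>2"
      using norm_of_real[of "1 - \<rho>", where 'a = complex] by (simp add: D_def del: norm_of_real)
    then show ?thesis using \<rho> by simp
  qed
  ultimately have "\<forall>\<^sub>F t in nhds 0. D t < 2 * (1 - \<rho>)\<^sup>2"
    by (metis isCont_def tendsto_at_iff_tendsto_nhds order_tendstoD(2))
  then obtain d where d: "d > 0" "\<And>t. \<bar>t\<bar> < d \<Longrightarrow> D t < 2 * (1 - \<rho>)\<^sup>2"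
    by (auto simp: eventually_nhds_metric)
  \<comment> \<open>Half of \<open>d\<close> gives a strict inequality at distance
    \<open>\<delta>\<close>, and the bound \<open>1 / 4\<close> keeps \<open>T\<close> a
    nondegenerate interval.\<close>
  define \<delta> where "\<delta> = min (d / 2) (1 / 4)"
  have \<delta>: "0 < \<delta>" "\<delta> < d" "\<delta> < 1 / 2" using d(1) by (auto simp: \<delta>_def)
  define T where "T = {\<delta>..1 - \<delta>}"
  have T: "T \<subseteq> {0<..<1}" using \<delta> by (auto simp: T_def)
  have D: "D t < 2 * (1 - \<rho>)\<^sup>2" if "t \<in> {0..1}" "t \<notin> T" for t
  proof -
    \<comment> \<open>By periodicity the end of the interval near 1 is treated like the one near
      0.\<close>
    have "D (t - 1) = D t"
      by (simp add: D_def right_diff_distrib flip: cis_divide)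
    then show ?thesis
      using d(2)[of t] d(2)[of "t - 1"] that \<delta> by (auto simp: T_def)
  qed
  have Dpos: "D t > 0" for t
  proof -
    have "cis (2 * pi * t) \<noteq> of_real \<rho>"
      using \<rho> by (metis abs_of_pos less_irrefl norm_cis norm_of_real)
    then show ?thesis by (simp add: D_def)
  qed
  define K where "K = (\<lambda>t. cis (2 * pi * t)) ` T"
  have K: "compact K" unfolding K_def T_def
    by (intro compact_continuous_image continuous_intros) auto
  have Ks: "K \<subseteq> sphere 0 1" "K \<subseteq> cball 0 1 - {1}"
    using T cis_in by (auto simp: K_def)
  have anK: "F analytic_on K" by (rule analytic_on_subset[OF an Ks(2)])
  have fr: "\<exists>\<^sub>F z in at a. F z \<noteq> 0" if "a \<in> K" for a
    using that Ks(1) by (intro frequently_nonzero) auto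
  have "isCont F (of_real \<rho>)"
    using \<rho> by (intro analytic_at_imp_isCont analytic_on_subset[OF an]) auto
  moreover have "((\<lambda>r. of_real r * of_real \<rho>) \<longlongrightarrow> of_real 1 * (of_real \<rho> :: complex)) (at_left 1)"
    by (intro tendsto_intros)
  ultimately have "((\<lambda>r. F (of_real r * of_real \<rho>)) \<longlongrightarrow> F (of_real \<rho>)) (at_left 1)"
    using isCont_tendsto_compose[of "of_real \<rho>" F] by simp
  moreover have "F (of_real \<rho>) \<noteq> 0" using \<rho> by (intro nz) simp
  ultimately have "((\<lambda>r. (1 - \<rho>) * - ln (cmod (F (of_real r * of_real \<rho>)))) \<longlongrightarrow> (1 - \<rho>) * - ln (cmod (F (of_real \<rho>)))) (at_left 1)"
    by (intro tendsto_intros) auto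
  then have "\<forall>\<^sub>F r in at_left 1. (1 - \<rho>) * - ln (cmod (F (of_real r * of_real \<rho>))) < e"
    using \<rho>(3) by (rule order_tendstoD(2))
  moreover have "\<forall>\<^sub>F r in at_left 1. \<forall>z\<in>K. exp (- e) * cmod (F z) \<le> cmod (F (of_real r * z))"
    using e by (intro radial_lower_bound K Ks anK fr) auto
  moreover have "\<forall>\<^sub>F r in at_left (1::real). 0 < r \<and> r < 1"
    using eventually_at_left_real[of 0 1] by simp
  \<comment> \<open>Both estimates have to hold for the same radius.\<close>
  ultimately have "\<forall>\<^sub>F r in at_left 1. (0 < r \<and> r < 1) \<and>
      (\<forall>z\<in>K. exp (- e) * cmod (F z) \<le> cmod (F (of_real r * z))) \<and>
      (1 - \<rho>) * - ln (cmod (F (of_real r * of_real \<rho>))) < e"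
    by eventually_elim auto
  then have "\<exists>r. (0 < r \<and> r < 1) \<and>
      (\<forall>z\<in>K. exp (- e) * cmod (F z) \<le> cmod (F (of_real r * z))) \<and>
      (1 - \<rho>) * - ln (cmod (F (of_real r * of_real \<rho>))) < e"
    by (rule eventually_happens'[rotated]) simp
  then obtain r where r: "0 < r" "r < 1"
      "\<And>z. z \<in> K \<Longrightarrow> exp (- e) * cmod (F z) \<le> cmod (F (of_real r * z))"
      "(1 - \<rho>) * - ln (cmod (F (of_real r * of_real \<rho>))) < e"
    by blast
  \<comment> \<open>At these points \<open>?u\<close> has the default value 0 instead of infinity,
    so the domination by \<open>?u + e\<close> may fail there. The set is finite since zeros of
    \<open>F\<close> cannot accumulate on the compact arc.\<close>
  define Z where "Z = {t \<in> T. F (cis (2 * pi * t)) = 0}"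
  have finZ: "finite Z"
  proof -
    have "\<not> a islimpt {z. F z = 0}" if "a \<in> K" for a
    proof -
      have "F analytic_on {a}" using that anK by (auto intro: analytic_on_subset)
      with fr[OF that] have "\<forall>\<^sub>F z in at a. F z \<noteq> 0"
        by (intro non_zero_neighbour isolated_singularity_at_analytic not_essential_analytic)
      then show ?thesis by (simp add: islimpt_iff_eventually)
    qed
    then have "finite (K \<inter> {z. F z = 0})"
      by (rule finite_not_islimpt_in_compact[OF K])
    moreover have "(\<lambda>t. cis (2 * pi * t)) ` Z \<subseteq> K \<inter> {z. F z = 0}"
      by (auto simp: Z_def K_def)
    moreover have "inj_on (\<lambda>t. cis (2 * pi * t)) Z"
      using T by (intro inj_on_subset[OF inj_on_cis_2pi]) (auto simp: Z_def)
    ultimately show ?thesis by (metis finite_subset finite_imageD)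
  qed
  define v where "v t = - ln (cmod (F (of_real r * cis (2 * pi * t))))" for t
  have v0: "v t \<ge> 0" for t
    using log_nonpos[of "of_real r * cis (2 * pi * t)"] scaled_in[of r "2 * pi * t"] r(1,2)
    by (force simp: v_def)
  define k where "k t = (1 - \<rho>\<^sup>2) / D t" for t
  have k0: "k t \<ge> 0" for t
    using \<rho> by (simp add: k_def D_def abs_square_le_1 power_le_one)
  \<comment> \<open>Since \<open>1 - \<rho>\<^sup>2 = (1 - \<rho>) * (1 + \<rho>)\<close>, the
    right-hand side is \<open>2 * (1 - \<rho>)\<^sup>2 * (1 + \<rho>) / D t\<close>, and
    \<open>D t\<close> is below the numerator off \<open>T\<close>.\<close>
  have k1: "1 \<le> 2 * (1 - \<rho>) * k t" if "t \<in> {0..1}" "t \<notin> T" for t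
  proof -
    have "D t \<le> 2 * (1 - \<rho>)\<^sup>2 * (1 + \<rho>)"
      using D[OF that] \<rho> by (smt (verit) mult_le_cancel_left1 zero_less_power)
    then show ?thesis
      using Dpos[of t] by (simp add: k_def field_simps power2_eq_square)
  qed
  define w where "w t = (if t \<in> T then ?u t + e else 0) + 2 * (1 - \<rho>) * (k t * v t)" for t
  have vI: "(v has_integral - ln (cmod (F 0))) {0..1}"
    using has_integral_neg[OF poisson_scaled[OF r(1,2), of 0]] by (simp add: v_def[abs_def])
  have kvI: "((\<lambda>t. k t * v t) has_integral - ln (cmod (F (of_real r * of_real \<rho>)))) {0..1}"
    using has_integral_neg[OF poisson_scaled[OF r(1,2), of "of_real \<rho>"]] \<rho>
    by (simp add: v_def[abs_def] k_def D_def)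
  have uint: "?u integrable_on {0<..<1}"
    using boundary_integral_ge(1) by (intro integrable_neg absolutely_integrable_on_def[THEN iffD1, THEN conjunct1])
  have uT: "?u integrable_on T"
    using boundary_integral_ge(1) T by (intro integrable_neg absolutely_integrable_on_def[THEN iffD1, THEN conjunct1])
       (auto simp: T_def intro: set_integrable_subset)
  have "((\<lambda>t. ?u t + e) has_integral integral T ?u + (1 - 2 * \<delta>) * e) T"
    using has_integral_add[OF integrable_integral[OF uT] has_integral_const_real[of e "\<delta>" "1 - \<delta>", folded T_def]] \<delta>
    by (simp add: T_def)
  then have "((\<lambda>t. if t \<in> T then ?u t + e else 0) has_integral integral T ?u + (1 - 2 * \<delta>) * e) {0..1}"
    using \<delta> by (subst has_integral_restrict) (auto simp: T_def)
  from has_integral_add[OF this has_integral_mult_right[OF kvI, of "2 * (1 - \<rho>)"]]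
  have wI: "(w has_integral (integral T ?u + (1 - 2 * \<delta>) * e + 2 * (1 - \<rho>) * - ln (cmod (F (of_real r * of_real \<rho>))))) {0..1}"
    by (simp add: w_def[abs_def])
  \<comment> \<open>On the finite set \<open>Z\<close> the majorant is replaced by \<open>v\<close>
    itself, which makes the comparison hold everywhere without changing the integral.\<close>
  have wI': "((\<lambda>t. if t \<in> Z then v t else w t) has_integral (integral T ?u + (1 - 2 * \<delta>) * e + 2 * (1 - \<rho>) * - ln (cmod (F (of_real r * of_real \<rho>))))) {0..1}"
    by (rule has_integral_spike_finite[OF finZ _ wI]) auto
  have "- ln (cmod (F 0)) \<le> integral T ?u + (1 - 2 * \<delta>) * e + 2 * (1 - \<rho>) * - ln (cmod (F (of_real r * of_real \<rho>)))"
  proof (rule has_integral_le[OF vI wI'])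
    fix t :: real assume t: "t \<in> {0..1}"
    show "v t \<le> (if t \<in> Z then v t else w t)"
    proof (cases "t \<in> T")
      case True
      have "v t \<le> ?u t + e" if "t \<notin> Z"
      proof -
        let ?z = "cis (2 * pi * t)"
        have "F ?z \<noteq> 0" using that True by (simp add: Z_def)
        moreover have "exp (- e) * cmod (F ?z) \<le> cmod (F (of_real r * ?z))"
          using True by (intro r(3)) (simp add: K_def)
        moreover have "F (of_real r * ?z) \<noteq> 0" using r by (intro nz scaled_in) auto
        ultimately have "ln (exp (- e) * cmod (F ?z)) \<le> ln (cmod (F (of_real r * ?z)))"
          by (subst ln_le_cancel_iff) auto
        then show ?thesis
          using \<open>F ?z \<noteq> 0\<close> by (simp add: ln_mult v_def)
      qed
      moreover have "0 \<le> 2 * (1 - \<rho>) * (k t * v t)" using \<rho> k0 v0 by simp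
      ultimately show ?thesis using True by (auto simp: w_def)
    next
      case False
      then have "1 * v t \<le> (2 * (1 - \<rho>) * k t) * v t"
        using t by (intro mult_right_mono k1 v0)
      then show ?thesis using False by (auto simp: w_def mult_ac)
    qed
  qed
  moreover have "integral T ?u \<le> integral {0<..<1} ?u"
    using log_nonpos[OF cis_in] by (intro integral_subset_le T uT uint) auto
  moreover have "(1 - 2 * \<delta>) * e \<le> e" using \<delta> e by simp
  ultimately show "- ln (cmod (F 0)) \<le> integral {0<..<1} ?u + e'"
    using r(4) unfolding e_def by linarith
qed

text \<open>The assumption excludes a point mass at 1. It fails, as does the conclusion, for
  \<open>exp (- (1 + z) / (1 - z))\<close>, which has modulus 1 on the circle minus 1 but modulus
  \<open>exp (- 1)\<close> at 0.\<close>

lemma mean_value_log_norm_disc: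
  assumes "\<And>e. e > 0 \<Longrightarrow> \<exists>\<rho>. 0 < \<rho> \<and> \<rho> < 1 \<and> (1 - \<rho>) * - ln (cmod (F (of_real \<rho>))) < e"
  shows "(\<lambda>t. ln (cmod (F (cis (2 * pi * t))))) absolutely_integrable_on {0<..<1} \<and>
    integral {0<..<1} (\<lambda>t. ln (cmod (F (cis (2 * pi * t))))) = ln (cmod (F 0))"
  using boundary_integral_ge boundary_integral_le[OF assms] by simp

end

subsection \<open>The Poisson formula in the right half plane\<close>

text \<open>With \<open>u = arctan (x / \<sigma>)\<close> the left-hand side is
  \<open>- cis (- u) / cis u\<close>, and \<open>cis u\<close> is a positive multiple of
  \<open>\<sigma> + \<i> * x\<close>. This matches the parameter of the circle with the imaginary
  axis.\<close>

lemma cis_arctan_eq_Moebius: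
  fixes x \<sigma> :: real
  assumes "\<sigma> > 0"
  shows "cis (2 * pi * (1 / 2 - arctan (x / \<sigma>) / pi)) = (\<i> * x - \<sigma>) / (\<i> * x + \<sigma>)"
proof -
  define u where "u = arctan (x / \<sigma>)"
  have "cos u \<noteq> 0" using cos_arctan_not_zero by (simp add: u_def)
  have "sin u / cos u = x / \<sigma>"
    using tan_arctan[of "x / \<sigma>"] by (simp add: u_def tan_def)
  then have x: "x = \<sigma> * sin u / cos u" using assms by (simp add: field_simps)
  define s c where "s = complex_of_real (sin u)" and "c = complex_of_real (cos u)"
  have sc: "s\<^sup>2 + c\<^sup>2 = 1"
    unfolding s_def c_def by (metis of_real_1 of_real_add of_real_power sin_cos_squared_add)
  have c0: "c \<noteq> 0" using \<open>cos u \<noteq> 0\<close> by (simp add: c_def)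
  have cu: "cis u = c + \<i> * s" "cis (- u) = c - \<i> * s"
    by (auto simp: complex_eq_iff s_def c_def)
  have nz: "c + \<i> * s \<noteq> 0" using cu(1) by (metis cis_neq_zero)
  have "cis (2 * pi * (1 / 2 - u / pi)) = cis (pi - 2 * u)"
    by (simp add: right_diff_distrib)
  also have "\<dots> = cis pi * (cis (- u) / cis u)"
    unfolding cis_divide cis_mult by (simp add: algebra_simps)
  also have "\<dots> = - (cis (- u) / cis u)" by simp
  also have "\<dots> = - (c - \<i> * s) / (c + \<i> * s)" unfolding cu by (rule minus_divide_left)
  also have "\<dots> = (\<i> * x - \<sigma>) / (\<i> * x + \<sigma>)"
  proof -
    have "\<i> * of_real x - of_real \<sigma> = (of_real \<sigma> / c) * - (c - \<i> * s)"
      "\<i> * of_real x + of_real \<sigma> = (of_real \<sigma> / c) * (c + \<i> * s)"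
      using c0 by (simp_all add: x s_def[symmetric] c_def[symmetric] field_simps)
    then show ?thesis using assms c0 by simp
  qed
  finally show ?thesis by (simp add: u_def)
qed

text \<open>Transport of the mean value property by a Moebius map centred at
  \<open>Complex \<sigma> \<eta>\<close>. The growth condition along a horizontal line becomes the
  smallness condition along the radius towards 1.\<close>

lemma poisson_log_norm_half_plane:
  assumes an: "f analytic_on {s. Re s \<ge> 0}"
    and bd: "\<And>s. Re s \<ge> 0 \<Longrightarrow> cmod (f s) \<le> 1"
    and nz: "\<And>s. Re s > 0 \<Longrightarrow> f s \<noteq> 0"
    and growth: "((\<lambda>x. ln (cmod (f (Complex x \<eta>))) / x) \<longlongrightarrow> 0) at_top"
    and \<sigma>: "\<sigma> > 0"
  shows "has_bochner_integral lborel (poisson_integrand f \<sigma> \<eta>) (pi * ln (cmod (f (Complex \<sigma> \<eta>))))"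
proof -
  define z where "z = Complex \<sigma> \<eta>"
  \<comment> \<open>Maps the unit disc onto the right half plane, 0 to \<open>z\<close> and 1 to
    infinity.\<close>
  define \<phi> where "\<phi> w = (z + cnj z * w) / (1 - w)" for w
  define F where "F = f \<circ> \<phi>"
  have Re_\<phi>: "Re (\<phi> w) = \<sigma> * (1 - (cmod w)\<^sup>2) / (cmod (1 - w))\<^sup>2" for w
    unfolding \<phi>_def Re_divide' cmod_power2
    by (simp add: z_def algebra_simps power2_eq_square)
  have "\<phi> analytic_on (cball 0 1 - {1})"
    unfolding \<phi>_def by (intro analytic_intros) auto
  moreover have "Re (\<phi> w) \<ge> 0" if "w \<in> cball 0 1" for w
    using that \<sigma> by (simp add: Re_\<phi> power_le_one)
  ultimately have anF: "F analytic_on (cball 0 1 - {1})"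
    unfolding F_def by (intro analytic_on_compose_gen[OF _ an]) auto
  have bdF: "cmod (F w) \<le> 1" if "w \<in> cball 0 1 - {1}" for w
    using that \<sigma> by (auto simp: F_def Re_\<phi> power_le_one intro!: bd)
  have nzF: "F w \<noteq> 0" if "cmod w < 1" for w
  proof -
    have "w \<noteq> 1" "(cmod w)\<^sup>2 < 1" using that by (auto simp: power_less_one_iff abs_square_less_1)
    then show ?thesis using \<sigma> by (simp add: F_def Re_\<phi> nz)
  qed
  have small: "\<exists>\<rho>. 0 < \<rho> \<and> \<rho> < 1 \<and> (1 - \<rho>) * - ln (cmod (F (of_real \<rho>))) < e" if e: "e > 0" for e
  proof -
    have "\<forall>\<^sub>F x in at_top. ln (cmod (f (Complex x \<eta>))) / x > - (e / (2 * \<sigma>))"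
      using e \<sigma> by (intro order_tendstoD(1)[OF growth]) auto
    then have "\<forall>\<^sub>F x in at_top. ln (cmod (f (Complex x \<eta>))) / x > - (e / (2 * \<sigma>)) \<and> x > \<sigma>"
      using eventually_gt_at_top by (rule eventually_conj)
    then obtain x where x: "ln (cmod (f (Complex x \<eta>))) / x > - (e / (2 * \<sigma>))" "x > \<sigma>"
      using eventually_happens'[of at_top] by (metis (no_types, lifting) trivial_limit_at_top_linorder)
    \<comment> \<open>The preimage of \<open>Complex x \<eta>\<close> under
      \<open>\<phi>\<close>.\<close>
    define \<rho> where "\<rho> = (x - \<sigma>) / (x + \<sigma>)"
    have \<rho>: "0 < \<rho>" "\<rho> < 1" "1 - \<rho> = 2 * \<sigma> / (x + \<sigma>)" "1 + \<rho> = 2 * x / (x + \<sigma>)"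
      using x(2) \<sigma> by (auto simp: \<rho>_def field_simps)
    have "z + cnj z * of_real \<rho> = Complex (\<sigma> * (1 + \<rho>)) (\<eta> * (1 - \<rho>))"
      by (simp add: z_def complex_eq_iff algebra_simps)
    moreover have "1 - complex_of_real \<rho> = of_real (1 - \<rho>)" by simp
    ultimately have "\<phi> (of_real \<rho>) = Complex (\<sigma> * ((1 + \<rho>) / (1 - \<rho>))) \<eta>"
      using \<rho>(2) unfolding \<phi>_def
      by (simp add: complex_eq_iff Re_divide_of_real Im_divide_of_real del: of_real_diff)
    also have "\<sigma> * ((1 + \<rho>) / (1 - \<rho>)) = x"
    proof -
      have "x + \<sigma> \<noteq> 0" using x(2) \<sigma> by simp
      then show ?thesis unfolding \<rho>(3,4) using \<sigma> by simp
    qed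
    finally have "F (of_real \<rho>) = f (Complex x \<eta>)" by (simp add: F_def)
    moreover have "ln (cmod (f (Complex x \<eta>))) \<le> 0"
      using bd[of "Complex x \<eta>"] nz[of "Complex x \<eta>"] x(2) \<sigma> by simp
    then have "(1 - \<rho>) * - ln (cmod (f (Complex x \<eta>))) \<le> 2 * \<sigma> / x * - ln (cmod (f (Complex x \<eta>)))"
      unfolding \<rho>(3) using x(2) \<sigma> by (intro mult_right_mono divide_left_mono) auto
    moreover have "\<dots> < e"
      using x \<sigma> by (simp add: field_simps)
    ultimately show ?thesis using \<rho> by auto
  qed
  define h where "h t = ln (cmod (F (cis (2 * pi * t))))" for t
  \<comment> \<open>The decreasing bijection from the line onto the open unit interval with
    \<open>\<phi> (cis (2 * pi * g \<omega>)) = \<i> * \<omega>\<close>. The absolute value of its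
    derivative is the Poisson kernel divided by \<open>pi\<close>.\<close>
  define g where "g \<omega> = 1 / 2 - arctan ((\<omega> - \<eta>) / \<sigma>) / pi" for \<omega>
  define g' where "g' \<omega> = - (\<sigma> / (\<sigma>\<^sup>2 + (\<omega> - \<eta>)\<^sup>2)) / pi" for \<omega>
  have mv: "h absolutely_integrable_on {0<..<1} \<and> integral {0<..<1} h = ln (cmod (F 0))"
    unfolding h_def using anF bdF nzF small by (rule mean_value_log_norm_disc)
  have dg: "(g has_field_derivative g' \<omega>) (at \<omega> within UNIV)" for \<omega>
  proof -
    have "(g has_field_derivative - (1 / \<sigma> * inverse (1 + ((\<omega> - \<eta>) / \<sigma>)\<^sup>2)) / pi) (at \<omega>)"
      unfolding g_def using \<sigma> by (auto intro!: derivative_eq_intros)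
    also have "1 / \<sigma> * inverse (1 + ((\<omega> - \<eta>) / \<sigma>)\<^sup>2) = \<sigma> / (\<sigma>\<^sup>2 + (\<omega> - \<eta>)\<^sup>2)"
    proof -
      have "1 + ((\<omega> - \<eta>) / \<sigma>)\<^sup>2 = (\<sigma>\<^sup>2 + (\<omega> - \<eta>)\<^sup>2) / \<sigma>\<^sup>2"
        using \<sigma> by (simp add: field_simps)
      then show ?thesis using \<sigma> by (simp add: power2_eq_square)
    qed
    finally show ?thesis by (simp add: g'_def)
  qed
  have inj: "inj_on g UNIV"
    using \<sigma> by (auto simp: inj_on_def g_def arctan_eq_iff)
  have img: "g ` UNIV = {0<..<1}"
  proof safe
    fix \<omega>
    show "g \<omega> \<in> {0<..<1}"
      using arctan_bounded[of "(\<omega> - \<eta>) / \<sigma>"] pi_gt_zero by (auto simp: g_def field_simps)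
  next
    fix t :: real assume t: "t \<in> {0<..<1}"
    define \<omega> where "\<omega> = \<eta> + \<sigma> * tan (pi * (1 / 2 - t))"
    have "arctan (tan (pi * (1 / 2 - t))) = pi * (1 / 2 - t)"
    proof (rule arctan_tan)
      have "pi * t > 0" "pi * t < pi * 1" using t pi_gt_zero by (auto intro: mult_strict_left_mono)
      then show "- (pi / 2) < pi * (1 / 2 - t)" "pi * (1 / 2 - t) < pi / 2"
        by (simp_all add: right_diff_distrib)
    qed
    then have "g \<omega> = t" using \<sigma> by (simp add: g_def \<omega>_def)
    then show "t \<in> g ` UNIV" by blast
  qed
  have hg: "h (g \<omega>) = ln (cmod (f (\<i> * of_real \<omega>)))" for \<omega>
  proof -
    define w where "w = (\<i> * of_real (\<omega> - \<eta>) - of_real \<sigma>) / (\<i> * of_real (\<omega> - \<eta>) + of_real \<sigma>)"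
    have d: "\<i> * of_real (\<omega> - \<eta>) + of_real \<sigma> \<noteq> 0"
      using \<sigma> by (simp add: complex_eq_iff)
    have "cis (2 * pi * g \<omega>) = w"
      unfolding g_def w_def by (rule cis_arctan_eq_Moebius[OF \<sigma>])
    moreover have "\<phi> w = \<i> * of_real \<omega>"
    proof -
      have 1: "1 - w = 2 * of_real \<sigma> / (\<i> * of_real (\<omega> - \<eta>) + of_real \<sigma>)"
        using d by (simp add: w_def field_simps)
      have z: "z = of_real \<sigma> + \<i> * of_real \<eta>" "cnj z = of_real \<sigma> - \<i> * of_real \<eta>"
        by (simp_all add: z_def complex_eq_iff)
      have 2: "z + cnj z * w = 2 * of_real \<sigma> * (\<i> * of_real \<omega>) / (\<i> * of_real (\<omega> - \<eta>) + of_real \<sigma>)"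
        unfolding z w_def using d by (simp add: field_simps)
      show ?thesis unfolding \<phi>_def 1 2 using d \<sigma> by simp
    qed
    ultimately show ?thesis by (simp add: h_def F_def)
  qed
  have "(\<lambda>\<omega>. \<bar>g' \<omega>\<bar> * h (g \<omega>)) absolutely_integrable_on UNIV \<and>
      integral UNIV (\<lambda>\<omega>. \<bar>g' \<omega>\<bar> * h (g \<omega>)) = ln (cmod (F 0))"
    using mv unfolding img[symmetric]
    by (subst has_absolute_integral_change_of_variables_1'[OF _ dg inj]) auto
  moreover have "(\<lambda>\<omega>. \<bar>g' \<omega>\<bar> * h (g \<omega>)) = (\<lambda>\<omega>. poisson_integrand f \<sigma> \<eta> \<omega> / pi)"
  proof
    fix \<omega>
    have "\<bar>g' \<omega>\<bar> = \<sigma> / (\<sigma>\<^sup>2 + (\<omega> - \<eta>)\<^sup>2) / pi"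
      using \<sigma> by (simp add: g'_def)
    then show "\<bar>g' \<omega>\<bar> * h (g \<omega>) = poisson_integrand f \<sigma> \<eta> \<omega> / pi"
      by (simp add: hg poisson_integrand_def)
  qed
  moreover have "F 0 = f z" by (simp add: F_def \<phi>_def)
  ultimately have I: "(\<lambda>\<omega>. poisson_integrand f \<sigma> \<eta> \<omega> / pi) absolutely_integrable_on UNIV"
    "integral UNIV (\<lambda>\<omega>. poisson_integrand f \<sigma> \<eta> \<omega> / pi) = ln (cmod (f z))"
    by simp_all
  have meas: "poisson_integrand f \<sigma> \<eta> \<in> borel_measurable borel"
  proof -
    have "continuous_on {s. Re s \<ge> 0} f"
      by (intro holomorphic_on_imp_continuous_on analytic_imp_holomorphic an)
    then have "continuous_on UNIV (\<lambda>\<omega>::real. f (\<i> * of_real \<omega>))"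
      by (rule continuous_on_compose2) (auto intro!: continuous_intros)
    then have "(\<lambda>\<omega>::real. f (\<i> * of_real \<omega>)) \<in> borel_measurable borel"
      by (rule borel_measurable_continuous_onI)
    then show ?thesis unfolding poisson_integrand_def[abs_def] by measurable
  qed
  have "integrable lebesgue (\<lambda>\<omega>. poisson_integrand f \<sigma> \<eta> \<omega> / pi)"
    using I(1) by (simp add: set_integrable_def)
  then have "integrable lborel (\<lambda>\<omega>. poisson_integrand f \<sigma> \<eta> \<omega> / pi)"
    using meas by (subst (asm) integrable_completion) auto
  moreover have "integral\<^sup>L lborel (\<lambda>\<omega>. poisson_integrand f \<sigma> \<eta> \<omega> / pi) = ln (cmod (f z))"
    using set_lebesgue_integral_eq_integral(2)[OF I(1)] I(2) meas
      integral_completion[of "\<lambda>\<omega>. poisson_integrand f \<sigma> \<eta> \<omega> / pi" lborel]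
    by (simp add: set_lebesgue_integral_def)
  ultimately have "has_bochner_integral lborel (\<lambda>\<omega>. poisson_integrand f \<sigma> \<eta> \<omega> / pi) (ln (cmod (f z)))"
    by (simp add: has_bochner_integral_iff)
  from has_bochner_integral_mult_right[OF this, of pi] show ?thesis
    by (simp add: z_def)
qed

subsection \<open>Quasipolynomials and Blaschke products\<close>

text \<open>In the closed right half plane \<open>cmod (s + 1)\<close> is at least both 1 and
  \<open>cmod s\<close>, so its \<open>n\<close>-th power dominates every monomial of degree at most
  \<open>n\<close>.\<close>

lemma norm_poly_le_right_half_plane:
  fixes p :: "complex poly"
  assumes "degree p \<le> n"
  shows "\<exists>C. \<forall>s. Re s \<ge> 0 \<longrightarrow> cmod (poly p s) \<le> C * cmod (s + 1) ^ n"
proof (intro exI allI impI)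
  fix s :: complex assume s: "Re s \<ge> 0"
  have ge: "cmod (s + 1) \<ge> 1" "cmod (s + 1) \<ge> cmod s"
  proof -
    show "cmod (s + 1) \<ge> 1" using complex_Re_le_cmod[of "s + 1"] s by simp
    show "cmod (s + 1) \<ge> cmod s" using s by (auto simp: cmod_def power2_eq_square algebra_simps)
  qed
  have "cmod (poly p s) \<le> (\<Sum>i\<le>degree p. cmod (coeff p i) * cmod s ^ i)"
    unfolding poly_altdef by (rule sum_norm_le) (simp add: norm_mult norm_power)
  also have "\<dots> \<le> (\<Sum>i\<le>degree p. cmod (coeff p i) * cmod (s + 1) ^ n)"
  proof (intro sum_mono mult_left_mono)
    fix i assume "i \<in> {..degree p}"
    then have "cmod (s + 1) ^ i \<le> cmod (s + 1) ^ n" using assms ge(1) by (intro power_increasing) auto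
    then show "cmod s ^ i \<le> cmod (s + 1) ^ n"
      using power_mono[OF ge(2), of i] by simp
  qed simp
  finally show "cmod (poly p s) \<le> (\<Sum>i\<le>degree p. cmod (coeff p i)) * cmod (s + 1) ^ n"
    by (simp add: sum_distrib_right)
qed

lemma norm_poly_ge_at_infinity:
  fixes p :: "complex poly"
  assumes "p \<noteq> 0"
  shows "\<exists>c>0. \<forall>\<^sub>F s in at_infinity. c \<le> cmod (poly p s)"
proof (cases "degree p = 0")
  case True
  then obtain a where "p = [:a:]" by (metis degree_eq_zeroE)
  then show ?thesis using assms by (intro exI[of _ "cmod a"]) auto
next
  case False
  then have "filterlim (poly p) at_infinity at_infinity"
    by (intro filterlim_poly_at_infinity) simp
  then have "\<forall>\<^sub>F s in at_infinity. 1 \<le> cmod (poly p s)"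
    by (simp add: filterlim_at_infinity[of 0])
  then show ?thesis by (intro exI[of _ 1]) simp
qed

lemma filterlim_Complex_at_infinity: "filterlim (\<lambda>x. Complex x y) at_infinity at_top"
proof (rule filterlim_norm_at_top_imp_at_infinity, rule filterlim_at_top_mono[OF filterlim_ident])
  show "\<forall>\<^sub>F x in at_top. x \<le> cmod (Complex x y)"
    using complex_Re_le_cmod[of "Complex _ y"] by simp
qed

text \<open>Decay no faster than a power of \<open>x\<close> makes the logarithm at least a constant
  minus a multiple of \<open>ln x\<close>, which is negligible against \<open>x\<close>.\<close>

lemma ln_norm_div_tendsto_0:
  assumes bd: "\<And>s. Re s \<ge> 0 \<Longrightarrow> cmod (f s) \<le> 1" and c: "c > 0"
    and lower: "\<forall>\<^sub>F x in at_top. c \<le> cmod (f (Complex x y)) * cmod (Complex x y + 1) ^ n"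
  shows "((\<lambda>x. ln (cmod (f (Complex x y))) / x) \<longlongrightarrow> 0) at_top"
proof (rule tendsto_sandwich)
  have "((\<lambda>x::real. (ln c - real n * ln 3) / x - real n * (ln x / x)) \<longlongrightarrow> 0 - real n * 0) at_top"
    by (intro tendsto_intros ln_x_over_x_tendsto_0 tendsto_divide_0[OF tendsto_const]
          filterlim_at_top_imp_at_infinity filterlim_ident)
  then show "((\<lambda>x::real. (ln c - real n * (ln 3 + ln x)) / x) \<longlongrightarrow> 0) at_top"
    by (simp add: diff_divide_distrib add_divide_distrib algebra_simps)
  \<comment> \<open>From here on \<open>cmod (Complex x y + 1)\<close> is at most
    \<open>3 * x\<close>.\<close>
  have "\<forall>\<^sub>F x in at_top. x \<ge> 1 + \<bar>y\<bar>" by (rule eventually_ge_at_top)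
  with lower have *: "\<forall>\<^sub>F x in at_top. f (Complex x y) \<noteq> 0 \<and> x \<ge> 1 \<and>
      ln c - real n * (ln 3 + ln x) \<le> ln (cmod (f (Complex x y)))"
  proof eventually_elim
    case (elim x)
    have nz: "f (Complex x y) \<noteq> 0" using elim c by auto
    have "cmod (Complex x y + 1) \<le> \<bar>x + 1\<bar> + \<bar>y\<bar>"
      using cmod_le[of "Complex x y + 1"] by simp
    also have "\<dots> \<le> 3 * x" using elim by simp
    finally have "cmod (Complex x y + 1) \<le> 3 * x" .
    then have "c \<le> cmod (f (Complex x y)) * (3 * x) ^ n"
      using elim(1) by (meson mult_left_mono norm_ge_zero order_trans power_mono)
    then have "ln c \<le> ln (cmod (f (Complex x y)) * (3 * x) ^ n)"
      using c nz elim by (subst ln_le_cancel_iff) auto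
    also have "\<dots> = ln (cmod (f (Complex x y))) + real n * (ln 3 + ln x)"
      using nz elim(2) by (simp add: ln_mult ln_realpow distrib_left)
    finally show ?case using nz elim by simp
  qed
  show "\<forall>\<^sub>F x in at_top. (ln c - real n * (ln 3 + ln x)) / x \<le> ln (cmod (f (Complex x y))) / x"
    using * by eventually_elim (auto intro!: divide_right_mono)
  show "\<forall>\<^sub>F x in at_top. ln (cmod (f (Complex x y))) / x \<le> 0"
    using * by eventually_elim (use bd in \<open>auto intro!: divide_nonpos_pos\<close>)
qed simp

text \<open>Without dead time the function is the nonzero polynomial \<open>P + Q\<close>. With dead
  time the exponential factor makes the second term vanish along the horizontal line, while
  \<open>P\<close> stays away from 0.\<close>

lemma norm_quasipolynomial_ge:
  fixes P Q :: "complex poly" and t :: real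
  assumes P: "P \<noteq> 0" and t: "t \<ge> 0" and nz: "\<exists>s. poly P s + poly Q s * exp (- of_real t * s) \<noteq> 0"
  shows "\<exists>c>0. \<forall>\<^sub>F x in at_top. c \<le> cmod (poly P (Complex x y) + poly Q (Complex x y) * exp (- of_real t * Complex x y))"
proof (cases "t = 0")
  case True
  then have "P + Q \<noteq> 0" using nz by (auto simp flip: poly_add)
  then obtain c where "c > 0" "\<forall>\<^sub>F s in at_infinity. c \<le> cmod (poly (P + Q) s)"
    using norm_poly_ge_at_infinity by blast
  then show ?thesis
    using True eventually_compose_filterlim[OF _ filterlim_Complex_at_infinity] by force
next
  case False
  with t have t: "t > 0" by simp
  obtain c where c: "c > 0" "\<forall>\<^sub>F s in at_infinity. c \<le> cmod (poly P s)"
    using norm_poly_ge_at_infinity[OF P] by blast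
  obtain C where C: "\<And>s. Re s \<ge> 0 \<Longrightarrow> cmod (poly Q s) \<le> C * cmod (s + 1) ^ degree Q"
    using norm_poly_le_right_half_plane[of Q "degree Q"] by blast
  let ?m = "degree Q"
  have C0: "C \<ge> 0" using order_trans[OF norm_ge_zero C[of 0]] by simp
  have "((\<lambda>x. (t * x) ^ ?m / exp (t * x)) \<longlongrightarrow> 0) at_top"
    by (rule filterlim_compose[OF tendsto_power_div_exp_0])
      (use t in \<open>auto intro!: filterlim_tendsto_pos_mult_at_top tendsto_const filterlim_ident\<close>)
  \<comment> \<open>The constant comes from writing
    \<open>C * (3 * x) ^ ?m * exp (- (t * x))\<close> in terms of \<open>t * x\<close>.\<close>
  from tendsto_mult_right_zero[OF this, of "C * (3 / t) ^ ?m"]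
  have "\<forall>\<^sub>F x in at_top. C * (3 / t) ^ ?m * ((t * x) ^ ?m / exp (t * x)) < c / 2"
    using c(1) by (intro order_tendstoD(2)[of _ 0]) auto
  moreover have "\<forall>\<^sub>F x in at_top. x \<ge> 1 + \<bar>y\<bar>" by (rule eventually_ge_at_top)
  moreover have "\<forall>\<^sub>F x in at_top. c \<le> cmod (poly P (Complex x y))"
    by (rule eventually_compose_filterlim[OF c(2) filterlim_Complex_at_infinity])
  ultimately have "\<forall>\<^sub>F x in at_top. c / 2 \<le> cmod (poly P (Complex x y) + poly Q (Complex x y) * exp (- of_real t * Complex x y))"
  proof eventually_elim
    case (elim x)
    have "cmod (Complex x y + 1) \<le> \<bar>x + 1\<bar> + \<bar>y\<bar>"
      using cmod_le[of "Complex x y + 1"] by simp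
    also have "\<dots> \<le> 3 * x" using elim by simp
    finally have "C * cmod (Complex x y + 1) ^ ?m \<le> C * (3 * x) ^ ?m"
      using C0 by (intro mult_left_mono power_mono) auto
    moreover have "x \<ge> 0" using elim by simp
    ultimately have Q: "cmod (poly Q (Complex x y)) \<le> C * (3 * x) ^ ?m"
      using C[of "Complex x y"] by (metis complex.sel(1) order_trans)
    have "cmod (poly Q (Complex x y) * exp (- of_real t * Complex x y)) \<le> C * (3 * x) ^ ?m * exp (- (t * x))"
      using Q by (simp add: norm_mult)
    also have "\<dots> = C * (3 / t) ^ ?m * ((t * x) ^ ?m / exp (t * x))"
      using t by (simp add: exp_minus field_simps power_mult_distrib)
    finally have "cmod (poly Q (Complex x y) * exp (- of_real t * Complex x y)) \<le> c / 2"
      using elim(1) by linarith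
    then show ?case
      using elim(3) norm_diff_ineq[of "poly P (Complex x y)" "poly Q (Complex x y) * exp (- of_real t * Complex x y)"]
      by linarith
  qed
  then show ?thesis using c(1) by (intro exI[of _ "c / 2"]) simp
qed

text \<open>Induction on the degree, replacing one factor \<open>s - a\<close> by its mirror image
  \<open>s + cnj a\<close> at a time. The identity is stated without quotients so that it holds at
  every point.\<close>

lemma reflect_right_half_plane_roots:
  fixes P :: "complex poly"
  assumes "P \<noteq> 0"
  shows "\<exists>as P'. set as \<subseteq> rhp \<and> P' \<noteq> 0 \<and> (\<forall>s\<in>rhp. poly P' s \<noteq> 0) \<and>
    (\<forall>s. poly P s * (\<Prod>a\<leftarrow>as. s + cnj a) = poly P' s * (\<Prod>a\<leftarrow>as. s - a))"
  using assms
proof (induction "degree P" arbitrary: P rule: less_induct)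
  case less
  show ?case
  proof (cases "\<exists>a\<in>rhp. poly P a = 0")
    case False
    then show ?thesis using less.prems by (intro exI[of _ "[]"] exI[of _ P]) auto
  next
    case True
    then obtain a where a: "a \<in> rhp" "poly P a = 0" by blast
    then obtain R where R: "P = [:-a, 1:] * R" by (auto simp: poly_eq_0_iff_dvd)
    with less.prems have "R \<noteq> 0" by auto
    then have "degree R < degree P" unfolding R by (subst degree_mult_eq) auto
    from less.hyps[OF this \<open>R \<noteq> 0\<close>] obtain as P' where *: "set as \<subseteq> rhp" "P' \<noteq> 0"
      "\<forall>s\<in>rhp. poly P' s \<noteq> 0"
      "\<And>s. poly R s * (\<Prod>a\<leftarrow>as. s + cnj a) = poly P' s * (\<Prod>a\<leftarrow>as. s - a)" by blast
    show ?thesis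
    proof (intro exI[of _ "a # as"] exI[of _ "[:cnj a, 1:] * P'"] conjI ballI allI)
      show "poly ([:cnj a, 1:] * P') s \<noteq> 0" if "s \<in> rhp" for s
      proof -
        have "cnj a + s \<noteq> 0" using that a by (auto simp: rhp_def complex_eq_iff)
        moreover have "poly ([:cnj a, 1:] * P') s = (cnj a + s) * poly P' s"
          by (simp add: distrib_right)
        ultimately show ?thesis using that *(3) by (simp only: mult_eq_0_iff) blast
      qed
      show "poly P s * (\<Prod>a\<leftarrow>a # as. s + cnj a) = poly ([:cnj a, 1:] * P') s * (\<Prod>a\<leftarrow>a # as. s - a)" for s
      proof -
        have "poly P s * (\<Prod>a\<leftarrow>a # as. s + cnj a) = (s - a) * (s + cnj a) * (poly R s * (\<Prod>a\<leftarrow>as. s + cnj a))"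
          by (simp add: R algebra_simps)
        then show ?thesis unfolding *(4) by (simp add: algebra_simps)
      qed
      show "[:cnj a, 1:] * P' \<noteq> 0" using *(2) by (simp only: mult_eq_0_iff) auto
    qed (use a * in auto)
  qed
qed

lemma kappa_append_right: "kappa \<alpha> (xs @ \<beta>) s = kappa \<alpha> \<beta> s * kappa [] xs s"
  by (simp add: kappa_def)

text \<open>Division by zero yields 0, so a nonzero value of \<open>kappa\<close> excludes its
  formal poles as well as its zeros.\<close>

lemma kappa_nonzeroD:
  assumes "kappa \<alpha> \<beta> s \<noteq> 0"
  shows "\<And>a. a \<in> set \<alpha> \<Longrightarrow> s \<noteq> a" "\<And>b. b \<in> set \<beta> \<Longrightarrow> s + cnj b \<noteq> 0"
  using assms by (auto simp: kappa_def prod_list_zero_iff image_iff)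

lemma prod_list_divide_distrib:
  fixes f g :: "'b \<Rightarrow> 'a :: field"
  shows "(\<Prod>x\<leftarrow>xs. f x / g x) = (\<Prod>x\<leftarrow>xs. f x) / (\<Prod>x\<leftarrow>xs. g x)"
  by (induction xs) auto

lemma kappa_Nil_mult_eq:
  assumes "p * (\<Prod>a\<leftarrow>as. s + cnj a) = q * (\<Prod>a\<leftarrow>as. s - a)" "kappa [] as s \<noteq> 0"
  shows "p = q * kappa [] as s"
proof -
  have "(\<Prod>a\<leftarrow>as. s + cnj a) \<noteq> 0"
    using kappa_nonzeroD(2)[OF assms(2)] by (auto simp: prod_list_zero_iff)
  then show ?thesis
    using assms(1) by (simp add: kappa_def prod_list_divide_distrib field_simps)
qed

lemma analytic_kappa:
  assumes "kappa \<alpha> \<beta> s \<noteq> 0"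
  shows "kappa \<alpha> \<beta> analytic_on {s}"
proof -
  have 1: "(\<lambda>s. \<Prod>a\<leftarrow>xs. (s + cnj a) / (s - a)) analytic_on {s}" if "\<And>a. a \<in> set xs \<Longrightarrow> s \<noteq> a" for xs
    using that by (induction xs) (auto intro!: analytic_intros)
  have 2: "(\<lambda>s. \<Prod>b\<leftarrow>xs. (s - b) / (s + cnj b)) analytic_on {s}" if "\<And>a. a \<in> set xs \<Longrightarrow> s + cnj a \<noteq> 0" for xs
    using that by (induction xs) (auto intro!: analytic_intros)
  show ?thesis
    unfolding kappa_def[abs_def] using kappa_nonzeroD[OF assms]
    by (intro analytic_on_mult 1 2) auto
qed

text \<open>The points \<open>a\<close> and \<open>- cnj a\<close> are mirror images in the
  imaginary axis, so each point of the axis is equally far from both.\<close>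

lemma norm_kappa_imaginary:
  assumes "set \<alpha> \<subseteq> rhp" "set \<beta> \<subseteq> rhp" "Re s = 0"
  shows "cmod (kappa \<alpha> \<beta> s) = 1"
proof -
  have eq: "cmod (s + cnj a) = cmod (s - a)" "s - a \<noteq> 0" "s + cnj a \<noteq> 0" if "a \<in> rhp" for a
    using that assms(3) by (auto simp: rhp_def cmod_def complex_eq_iff power2_commute)
  have f: "cmod ((s + cnj a) / (s - a)) = 1" "cmod ((s - a) / (s + cnj a)) = 1" if "a \<in> rhp" for a
    unfolding norm_divide using eq[OF that] by auto
  have 1: "cmod (\<Prod>a\<leftarrow>xs. (s + cnj a) / (s - a)) = 1" if "set xs \<subseteq> rhp" for xs
    using that by (induction xs) (auto simp: norm_mult f simp del: times_divide_eq_left times_divide_eq_right)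
  have 2: "cmod (\<Prod>b\<leftarrow>xs. (s - b) / (s + cnj b)) = 1" if "set xs \<subseteq> rhp" for xs
    using that by (induction xs) (auto simp: norm_mult f simp del: times_divide_eq_left times_divide_eq_right)
  show ?thesis using assms by (simp add: kappa_def norm_mult 1 2)
qed

lemma tendsto_kappa_at_infinity: "(kappa \<alpha> \<beta> \<longlongrightarrow> 1) at_infinity"
proof -
  have f: "((\<lambda>s. (s + c) / (s - d)) \<longlongrightarrow> 1) at_infinity" for c d :: complex
  proof -
    have "filterlim (\<lambda>s. s - d) at_infinity at_infinity"
      using tendsto_add_filterlim_at_infinity'[OF filterlim_ident tendsto_const[of "-d"]] by simp
    then have "((\<lambda>s. 1 + (c + d) / (s - d)) \<longlongrightarrow> 1 + 0) at_infinity"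
      by (intro tendsto_intros tendsto_divide_0[OF tendsto_const])
    moreover have "\<forall>\<^sub>F s in at_infinity. 1 + (c + d) / (s - d) = (s + c) / (s - d)"
      using eventually_not_equal_at_infinity[of d] by eventually_elim (simp add: field_simps)
    ultimately show ?thesis by (auto intro: Lim_transform_eventually)
  qed
  \<comment> \<open>General \<open>u\<close> and \<open>v\<close> let one induction cover both
    products in \<open>kappa\<close>.\<close>
  have "((\<lambda>s. \<Prod>a\<leftarrow>xs. (s + u a) / (s - v a)) \<longlongrightarrow> 1) at_infinity" for u v :: "complex \<Rightarrow> complex" and xs
  proof (induction xs)
    case (Cons x xs)
    from tendsto_mult[OF f this] show ?case by simp
  qed simp
  from tendsto_mult[OF this[of cnj "\<lambda>a. a"] this[of "\<lambda>a. -a" "\<lambda>a. - cnj a"]] show ?thesis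
    by (simp add: kappa_def[abs_def])
qed

lemma zorder_eq_count_list_diff:
  assumes g: "g meromorphic_on {z}" and nz: "\<exists>\<^sub>F s in at z. g s \<noteq> 0"
    and \<alpha>: "zero_list g A \<alpha>" and \<beta>: "pole_list g A \<beta>" and z: "z \<in> A"
  shows "zorder g z = int (count_list \<alpha> z) - int (count_list \<beta> z)"
proof (cases "is_pole g z")
  case True
  then have "z \<in> poles_on g A" "z \<notin> zeros_on g A"
    using z not_tendsto_and_filterlim_at_infinity[of "at z" g 0]
    by (auto simp: zeros_on_def poles_on_def is_pole_def)
  then show ?thesis using \<alpha> \<beta> by (auto simp: zero_list_def pole_list_def count_list_0_iff)
next
  case False
  then have 0: "count_list \<beta> z = 0"
    using \<beta> by (auto simp: pole_list_def poles_on_def count_list_0_iff)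
  show ?thesis
  proof (cases "g \<midarrow>z\<rightarrow> 0")
    case True
    then show ?thesis using z \<alpha> 0 by (auto simp: zero_list_def zeros_on_def)
  next
    case False
    then have "zorder g z = 0"
      using \<open>\<not> is_pole g z\<close> by (intro not_pole_not_isolated_zero_imp_zorder_eq_0 g nz)
        (auto simp: isolated_zero_def)
    then show ?thesis using False \<alpha> 0 by (auto simp: zero_list_def zeros_on_def count_list_0_iff)
  qed
qed

subsection \<open>The modified sensitivity function\<close>

text \<open>Dead times add up. Only the shape of the product is kept, with the coefficients regarded
  as complex.\<close>

lemma transfer_function_mult:
  assumes "transfer_function A" "transfer_function B"
  shows "\<exists>(P :: complex poly) Q (t :: real). P \<noteq> 0 \<and> t \<ge> 0 \<and>
    (\<lambda>s. A s * B s) = (\<lambda>s. poly Q s / poly P s * exp (- of_real t * s))"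
proof -
  obtain Q1 P1 :: "real poly" and t1 where 1: "P1 \<noteq> 0" "t1 \<ge> 0"
    "A = (\<lambda>s. poly (map_poly of_real Q1) s / poly (map_poly of_real P1) s * exp (- of_real t1 * s))"
    using assms(1) unfolding transfer_function_def by blast
  obtain Q2 P2 :: "real poly" and t2 where 2: "P2 \<noteq> 0" "t2 \<ge> 0"
    "B = (\<lambda>s. poly (map_poly of_real Q2) s / poly (map_poly of_real P2) s * exp (- of_real t2 * s))"
    using assms(2) unfolding transfer_function_def by blast
  let ?c = "map_poly of_real :: real poly \<Rightarrow> complex poly"
  show ?thesis
  proof (rule exI[of _ "?c P1 * ?c P2"], rule exI[of _ "?c Q1 * ?c Q2"], rule exI[of _ "t1 + t2"],
      intro conjI ext)
    show "?c P1 * ?c P2 \<noteq> 0" using 1 2 by (simp add: map_poly_eq_0_iff)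
    show "A s * B s = poly (?c Q1 * ?c Q2) s / poly (?c P1 * ?c P2) s * exp (- of_real (t1 + t2) * s)" for s
    proof -
      have "exp (- of_real (t1 + t2) * s) = exp (- of_real t1 * s) * exp (- of_real t2 * s)"
        unfolding mult_exp_exp by (simp add: algebra_simps)
      then show ?thesis by (simp add: 1 2 mult_ac)
    qed
  qed (use 1 2 in auto)
qed

text \<open>The orders of \<open>kappa\<close> and of the sensitivity function cancel at every point
  of the half plane, and an analytic function of order 0 does not vanish.\<close>

lemma modified_sensitivity_nonzero:
  assumes G: "G meromorphic_on UNIV" and nz: "\<And>z. \<forall>\<^sub>F s in at z. 1 + G s \<noteq> 0"
    and zeros: "zero_list (sensitivity G) rhp \<alpha>" and poles: "pole_list (sensitivity G) rhp \<beta>"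
    and an: "modified_sensitivity G \<alpha> \<beta> analytic_on rhp" and z: "z \<in> rhp"
  shows "modified_sensitivity G \<alpha> \<beta> z \<noteq> 0"
proof -
  let ?k = "kappa \<alpha> \<beta>" and ?g = "sensitivity G" and ?m = "modified_sensitivity G \<alpha> \<beta>"
  have m: "(\<lambda>s. 1 / (1 + G s)) meromorphic_on {z}"
    by (intro meromorphic_intros meromorphic_on_subset[OF G]) auto
  then have g: "?g meromorphic_on {z}"
    unfolding sensitivity_def by (rule remove_sings_meromorphic)
  have "\<forall>\<^sub>F s in at z. ?g s = 1 / (1 + G s)"
    using m unfolding sensitivity_def by (intro eventually_remove_sings_eq_at) (simp add: meromorphic_at_iff)
  then have gnz: "\<forall>\<^sub>F s in at z. ?g s \<noteq> 0"
    using nz[of z] by eventually_elim auto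
  have kg: "(\<lambda>s. ?k s * ?g s) meromorphic_on {z}"
    by (intro meromorphic_intros kappa_meromorphic g)
  have sub: "set \<alpha> \<union> set \<beta> \<subseteq> rhp"
    using zeros poles by (auto simp: zero_list_def pole_list_def zeros_on_def poles_on_def)
  have "zorder (\<lambda>s. ?k s * ?g s) z = zorder ?k z + zorder ?g z"
    by (intro zorder_mult kappa_meromorphic g eventually_frequently gnz eventually_kappa_nonzero) auto
  also have "zorder ?g z = int (count_list \<alpha> z) - int (count_list \<beta> z)"
    by (intro zorder_eq_count_list_diff[OF g _ zeros poles z] eventually_frequently gnz) auto
  also have "zorder ?k z = int (count_list \<beta> z) - int (count_list \<alpha> z)"
    using sub z by (intro zorder_kappa) (auto simp: rhp_def)
  finally have "zorder (\<lambda>s. ?k s * ?g s) z = 0" by simp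
  moreover have eq: "\<forall>\<^sub>F s in at z. ?m s = ?k s * ?g s"
    using kg unfolding modified_sensitivity_def
    by (intro eventually_remove_sings_eq_at) (simp add: meromorphic_at_iff)
  ultimately have 0: "zorder ?m z = 0"
    using zorder_cong[OF eq refl] by simp
  have "\<forall>\<^sub>F s in at z. ?m s \<noteq> 0"
    using eq gnz eventually_kappa_nonzero[of \<alpha> \<beta> z] by eventually_elim auto
  moreover have "?m analytic_on {z}" using an z by (auto intro: analytic_on_subset)
  ultimately show ?thesis
    using 0 by (simp add: zorder_eq_0_iff eventually_frequently)
qed

text \<open>The modified sensitivity is written as \<open>f2 / f1\<close>, the Poisson formula is
  applied to \<open>f1\<close> and \<open>f2\<close> separately, and the results are
  subtracted.\<close>

lemma poisson_modified_sensitivity: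
  fixes P Q :: "complex poly" and t :: real
  assumes P: "P \<noteq> 0" and t: "t \<ge> 0"
    and G: "G = (\<lambda>s. poly Q s / poly P s * exp (- of_real t * s))"
    and Gm: "G meromorphic_on UNIV"
    and nz: "\<And>z. \<forall>\<^sub>F s in at z. 1 + G s \<noteq> 0"
    and \<alpha>: "set \<alpha> \<subseteq> rhp" and \<beta>: "set \<beta> \<subseteq> rhp"
    and an: "modified_sensitivity G \<alpha> \<beta> analytic_on rhp"
    and gnz: "\<And>z. z \<in> rhp \<Longrightarrow> modified_sensitivity G \<alpha> \<beta> z \<noteq> 0"
    and \<sigma>: "\<sigma> > 0"
  shows "has_bochner_integral lborel (poisson_integrand (modified_sensitivity G \<alpha> \<beta>) \<sigma> \<eta>)
    (pi * ln (cmod (modified_sensitivity G \<alpha> \<beta> (Complex \<sigma> \<eta>))))"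
proof -
  let ?m = "modified_sensitivity G \<alpha> \<beta>"
  obtain as P' where as: "set as \<subseteq> rhp" and P': "P' \<noteq> 0" "\<And>s. s \<in> rhp \<Longrightarrow> poly P' s \<noteq> 0"
    and reflect: "\<And>s. poly P s * (\<Prod>a\<leftarrow>as. s + cnj a) = poly P' s * (\<Prod>a\<leftarrow>as. s - a)"
    using reflect_right_half_plane_roots[OF P] by blast
  \<comment> \<open>Reflecting the right half plane roots of \<open>P\<close> contributes a Blaschke
    product over \<open>as\<close>, which is merged with the one of the modified
    sensitivity.\<close>
  define k where "k = kappa \<alpha> (as @ \<beta>)"
  define h where "h s = poly P s + poly Q s * exp (- of_real t * s)" for s
  \<comment> \<open>Large enough for \<open>(s + 1) ^ n\<close> to dominate \<open>P\<close>,
    \<open>Q\<close> and \<open>P'\<close> at the same time.\<close>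
  define n where "n = degree P + degree Q + degree P'"
  define E where "E s = h s / ((s + 1) ^ n * k s)" for s
  define E' where "E' = remove_sings E"
  define D where "D s = poly P' s / (s + 1) ^ n" for s
  have s1: "s + 1 \<noteq> 0" "cmod (s + 1) \<ge> 1" if "Re s \<ge> 0" for s
    using that complex_Re_le_cmod[of "s + 1"] by (auto simp: complex_eq_iff)
  have k1: "cmod (k s) = 1" if "Re s = 0" for s
    unfolding k_def using \<alpha> \<beta> as that by (intro norm_kappa_imaginary) auto

  \<comment> \<open>The quotient representation away from isolated points\<close>
  have poly_an: "poly p analytic_on S" for p :: "complex poly" and S
    by (rule analytic_on_subset[of _ UNIV]) (auto simp: analytic_on_open intro!: holomorphic_intros)
  have anh: "h analytic_on S" for S
    unfolding h_def[abs_def] by (intro analytic_intros poly_an)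
  have mer: "E meromorphic_on S" for S
    unfolding E_def[abs_def] k_def
    by (intro meromorphic_intros kappa_meromorphic analytic_on_imp_meromorphic_on anh)
  have poly_nz: "\<forall>\<^sub>F s in at z. poly p s \<noteq> 0" if "p \<noteq> 0" for p :: "complex poly" and z
    using islimpt_finite[OF poly_roots_finite[OF that], of z] by (simp add: islimpt_iff_eventually)
  have s1nz: "\<forall>\<^sub>F s in at z. s + 1 \<noteq> 0" for z :: complex
    using poly_nz[of "[:1, 1:]" z] by (simp add: add.commute)
  have rel: "\<forall>\<^sub>F s in at z. ?m s * E' s = D s \<and> E' s \<noteq> 0 \<and> D s \<noteq> 0 \<and> ?m s = D s / E s" for z
  proof -
    have inv: "(\<lambda>s. 1 / (1 + G s)) meromorphic_on {z}"
      by (intro meromorphic_intros meromorphic_on_subset[OF Gm]) auto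
    then have sens: "\<forall>\<^sub>F s in at z. sensitivity G s = 1 / (1 + G s)"
      unfolding sensitivity_def
      by (intro eventually_remove_sings_eq_at) (simp add: meromorphic_at_iff)
    have "sensitivity G meromorphic_on {z}"
      unfolding sensitivity_def by (rule remove_sings_meromorphic[OF inv])
    then have "(\<lambda>s. kappa \<alpha> \<beta> s * sensitivity G s) meromorphic_on {z}"
      by (intro meromorphic_intros kappa_meromorphic)
    then have m: "\<forall>\<^sub>F s in at z. ?m s = kappa \<alpha> \<beta> s * sensitivity G s"
      unfolding modified_sensitivity_def
      by (intro eventually_remove_sings_eq_at) (simp add: meromorphic_at_iff)
    have E': "\<forall>\<^sub>F s in at z. E' s = E s"
      unfolding E'_def using mer[of "{z}"]
      by (intro eventually_remove_sings_eq_at) (simp add: meromorphic_at_iff)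
    show ?thesis
      using sens m E' nz[of z] poly_nz[OF P, of z] poly_nz[OF P'(1), of z] s1nz[of z]
        eventually_kappa_nonzero[of \<alpha> \<beta> z] eventually_kappa_nonzero[of "[]" as z]
    proof eventually_elim
      case (elim s)
      have hP: "h s = poly P s * (1 + G s)"
        using elim by (simp add: h_def G field_simps)
      have Pk: "poly P s = poly P' s * kappa [] as s"
        by (rule kappa_Nil_mult_eq[OF reflect elim(9)])
      have "E s = poly P' s * (1 + G s) / ((s + 1) ^ n * kappa \<alpha> \<beta> s)"
        using elim unfolding E_def hP k_def kappa_append_right Pk by simp
      then show ?case using elim by (simp add: D_def)
    qed
  qed

  \<comment> \<open>Analyticity and absence of zeros\<close>
  have E_an: "E analytic_on {s}" if "Re s \<ge> 0" "k s \<noteq> 0" for s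
  proof -
    have "k analytic_on {s}" using that(2) unfolding k_def by (rule analytic_kappa)
    then show ?thesis
      unfolding E_def[abs_def] using that s1 by (intro analytic_intros anh) auto
  qed
  have D_an: "D analytic_on {s. Re s \<ge> 0}"
    unfolding D_def[abs_def] using s1 by (intro analytic_intros poly_an) auto
  \<comment> \<open>The formula for \<open>E\<close> may break down at zeros and poles of
    \<open>k\<close>. These singularities are removable because \<open>E\<close> agrees nearby with
    \<open>D / ?m\<close>, and \<open>?m\<close> is analytic without zeros in the half
    plane.\<close>
  have E'_rhp: "E' analytic_on {s} \<and> E' s = D s / ?m s" if "s \<in> rhp" for s
  proof -
    have a: "(\<lambda>s. D s / ?m s) analytic_on {s}"
      using that gnz by (intro analytic_intros analytic_on_subset[OF D_an] analytic_on_subset[OF an])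
        (auto simp: rhp_def)
    have "E' = remove_sings (\<lambda>s. D s / ?m s)"
    proof
      fix w
      have "\<forall>\<^sub>F v in at w. E v = D v / ?m v"
        using rel[of w] by eventually_elim auto
      then show "E' w = remove_sings (\<lambda>s. D s / ?m s) w"
        unfolding E'_def by (rule remove_sings_cong) simp
    qed
    then show ?thesis
      using remove_sings_analytic_on[OF a] remove_sings_at_analytic[OF a] by simp
  qed
  have E'_eq: "E' s = E s" if "Re s \<ge> 0" "k s \<noteq> 0" for s
    unfolding E'_def using E_an[OF that] by simp
  have E'_an: "E' analytic_on {s. Re s \<ge> 0}"
  proof (subst analytic_on_analytic_at, safe)
    fix s :: complex assume "Re s \<ge> 0"
    then consider "s \<in> rhp" | "Re s = 0" by (force simp: rhp_def)
    then show "E' analytic_on {s}"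
    proof cases
      case 2
      then have "k s \<noteq> 0" using k1[of s] by auto
      then show ?thesis
        unfolding E'_def using 2 by (intro remove_sings_analytic_on E_an) auto
    qed (use E'_rhp in blast)
  qed
  have E'_nz: "E' s \<noteq> 0" if "Re s > 0" for s
    using E'_rhp[of s] that P'(2)[of s] gnz[of s] s1[of s] by (simp add: rhp_def D_def)
  have D_nz: "D s \<noteq> 0" if "Re s > 0" for s
    using that P'(2)[of s] s1[of s] by (simp add: rhp_def D_def)

  \<comment> \<open>Boundedness in the closed half plane\<close>
  have k2: "\<forall>\<^sub>F s in at_infinity. 1 / 2 \<le> cmod (k s) \<and> cmod (k s) \<le> 2"
  proof -
    have "((\<lambda>s. cmod (k s)) \<longlongrightarrow> 1) at_infinity"
      using tendsto_norm[OF tendsto_kappa_at_infinity] by (simp add: k_def)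
    then have "\<forall>\<^sub>F s in at_infinity. 1 / 2 < cmod (k s)" "\<forall>\<^sub>F s in at_infinity. cmod (k s) < 2"
      by (rule order_tendstoD; simp)+
    then show ?thesis by eventually_elim auto
  qed
  obtain C where C: "\<And>s. Re s \<ge> 0 \<Longrightarrow> cmod (D s) \<le> C \<and> cmod (E' s) \<le> C"
  proof -
    obtain CP CQ CD where CP: "\<And>s. Re s \<ge> 0 \<Longrightarrow> cmod (poly P s) \<le> CP * cmod (s + 1) ^ n"
      and CQ: "\<And>s. Re s \<ge> 0 \<Longrightarrow> cmod (poly Q s) \<le> CQ * cmod (s + 1) ^ n"
      and CD: "\<And>s. Re s \<ge> 0 \<Longrightarrow> cmod (poly P' s) \<le> CD * cmod (s + 1) ^ n"
      using norm_poly_le_right_half_plane[of P n] norm_poly_le_right_half_plane[of Q n]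
        norm_poly_le_right_half_plane[of P' n] by (auto simp: n_def)
    have Dle: "cmod (D s) \<le> CD" if "Re s \<ge> 0" for s
      using CD[OF that] s1[OF that] by (simp add: D_def norm_divide norm_power divide_le_eq)
    have hle: "cmod (h s) \<le> (CP + CQ) * cmod (s + 1) ^ n" if "Re s \<ge> 0" for s
    proof -
      have "cmod (exp (- of_real t * s)) \<le> 1" using that t by simp
      then have "cmod (poly Q s * exp (- of_real t * s)) \<le> cmod (poly Q s)"
        unfolding norm_mult by (intro mult_left_le) auto
      then show ?thesis
        unfolding h_def distrib_right using CP[OF that] CQ[OF that]
        by (intro norm_triangle_le) linarith
    qed
    \<comment> \<open>Outside radius \<open>R\<close> the bound for \<open>h\<close> carries over,
      as \<open>k\<close> is at least \<open>1 / 2\<close> in modulus; inside, continuity of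
      \<open>E'\<close> on a compact set suffices.\<close>
    obtain R where R: "\<And>s. cmod s \<ge> R \<Longrightarrow> 1 / 2 \<le> cmod (k s) \<and> cmod (k s) \<le> 2"
      using k2 unfolding eventually_at_infinity by blast
    have "compact ({s. Re s \<ge> 0} \<inter> cball 0 R)"
      by (intro closed_Int_compact closed_halfspace_Re_ge) auto
    moreover have "continuous_on ({s. Re s \<ge> 0} \<inter> cball 0 R) E'"
      by (intro holomorphic_on_imp_continuous_on analytic_imp_holomorphic analytic_on_subset[OF E'_an]) auto
    ultimately have "bounded (E' ` ({s. Re s \<ge> 0} \<inter> cball 0 R))"
      by (intro compact_imp_bounded compact_continuous_image)
    then obtain B where "\<forall>w \<in> E' ` ({s. Re s \<ge> 0} \<inter> cball 0 R). cmod w \<le> B"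
      unfolding bounded_iff by blast
    then have B: "cmod (E' s) \<le> B" if "Re s \<ge> 0" "cmod s \<le> R" for s
      using that by simp
    have E'le: "cmod (E' s) \<le> max B (2 * (CP + CQ))" if "Re s \<ge> 0" for s
    proof (cases "cmod s \<le> R")
      case False
      then have k: "1 / 2 \<le> cmod (k s)" using R[of s] by simp
      then have "k s \<noteq> 0" by auto
      then have "cmod (E' s) = cmod (h s) / cmod (s + 1) ^ n / cmod (k s)"
        using that by (simp add: E'_eq E_def norm_divide norm_mult norm_power)
      also have "\<dots> \<le> (CP + CQ) / (1 / 2)"
      proof (rule frac_le)
        show "cmod (h s) / cmod (s + 1) ^ n \<le> CP + CQ"
          using hle[OF that] s1[OF that] by (simp add: divide_le_eq)
        then show "0 \<le> CP + CQ" by (rule order_trans[rotated]) simp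
      qed (use k in auto)
      finally show ?thesis by simp
    next
      case True
      show ?thesis using B[OF that True] by simp
    qed
    show ?thesis
    proof (rule that[of "max CD (max B (2 * (CP + CQ)))"])
      fix s :: complex assume "Re s \<ge> 0"
      from Dle[OF this] E'le[OF this] show "cmod (D s) \<le> max CD (max B (2 * (CP + CQ))) \<and>
          cmod (E' s) \<le> max CD (max B (2 * (CP + CQ)))"
        by linarith
    qed
  qed
  have "C > 0"
    using C[of 1] D_nz[of 1] by (smt (verit) one_complex.sel(1) zero_less_norm_iff)

  \<comment> \<open>Normalisation and growth along horizontal lines\<close>
  define f1 f2 where "f1 s = E' s / of_real C" and "f2 s = D s / of_real C" for s
  have bd1: "cmod (f1 s) \<le> 1" and bd2: "cmod (f2 s) \<le> 1" if "Re s \<ge> 0" for s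
    using C[OF that] \<open>C > 0\<close> by (auto simp: f1_def f2_def norm_divide)
  have an1: "f1 analytic_on {s. Re s \<ge> 0}" and an2: "f2 analytic_on {s. Re s \<ge> 0}"
    unfolding f1_def[abs_def] f2_def[abs_def] using \<open>C > 0\<close> by (intro analytic_intros E'_an D_an; simp)+
  have ge0: "\<forall>\<^sub>F x in at_top. x \<ge> (0::real)" by (rule eventually_ge_at_top)
  have growth2: "((\<lambda>x. ln (cmod (f2 (Complex x \<eta>))) / x) \<longlongrightarrow> 0) at_top"
  proof -
    obtain c where c: "c > 0" "\<forall>\<^sub>F s in at_infinity. c \<le> cmod (poly P' s)"
      using norm_poly_ge_at_infinity[OF P'(1)] by blast
    have "\<forall>\<^sub>F x in at_top. c \<le> cmod (poly P' (Complex x \<eta>))"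
      by (rule eventually_compose_filterlim[OF c(2) filterlim_Complex_at_infinity])
    then have "\<forall>\<^sub>F x in at_top. c / C \<le> cmod (f2 (Complex x \<eta>)) * cmod (Complex x \<eta> + 1) ^ n"
      using ge0
    proof eventually_elim
      case (elim x)
      then show ?case
        using s1[of "Complex x \<eta>"] \<open>C > 0\<close>
        by (simp add: f2_def D_def norm_divide norm_mult norm_power divide_right_mono)
    qed
    then show ?thesis using c(1) \<open>C > 0\<close> by (intro ln_norm_div_tendsto_0[OF bd2]) auto
  qed
  have growth1: "((\<lambda>x. ln (cmod (f1 (Complex x \<eta>))) / x) \<longlongrightarrow> 0) at_top"
  proof -
    \<comment> \<open>Any base point would do; it is only to be shown that \<open>h\<close> does not
      vanish identically.\<close>
    have "\<forall>\<^sub>F s in at 0. h s \<noteq> 0"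
      using nz[of 0] poly_nz[OF P, of 0] by eventually_elim (auto simp: h_def G field_simps)
    then have "\<exists>s. h s \<noteq> 0" by (rule eventually_happens'[rotated]) simp
    then obtain c where c: "c > 0" "\<forall>\<^sub>F x in at_top. c \<le> cmod (h (Complex x \<eta>))"
      using norm_quasipolynomial_ge[OF P t, of Q \<eta>] unfolding h_def by auto
    have "\<forall>\<^sub>F x in at_top. 1 / 2 \<le> cmod (k (Complex x \<eta>)) \<and> cmod (k (Complex x \<eta>)) \<le> 2"
      by (rule eventually_compose_filterlim[OF k2 filterlim_Complex_at_infinity])
    with c(2) ge0 have "\<forall>\<^sub>F x in at_top. c / (2 * C) \<le> cmod (f1 (Complex x \<eta>)) * cmod (Complex x \<eta> + 1) ^ n"
    proof eventually_elim
      case (elim x)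
      let ?s = "Complex x \<eta>"
      have "k ?s \<noteq> 0" using elim by auto
      then have "cmod (f1 ?s) * cmod (?s + 1) ^ n = cmod (h ?s) / (cmod (k ?s) * C)"
        using s1[of ?s] elim \<open>C > 0\<close>
        by (simp add: f1_def E'_eq E_def norm_divide norm_mult norm_power)
      moreover have "c / (2 * C) \<le> cmod (h ?s) / (cmod (k ?s) * C)"
        using elim \<open>C > 0\<close> c(1) \<open>k ?s \<noteq> 0\<close> by (intro frac_le) auto
      ultimately show ?case by simp
    qed
    then show ?thesis using c(1) \<open>C > 0\<close> by (intro ln_norm_div_tendsto_0[OF bd1]) auto
  qed
  have nz1: "f1 s \<noteq> 0" and nz2: "f2 s \<noteq> 0" if "Re s > 0" for s
    using E'_nz[OF that] D_nz[OF that] \<open>C > 0\<close> by (auto simp: f1_def f2_def)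
  have I: "has_bochner_integral lborel (\<lambda>\<omega>. poisson_integrand f2 \<sigma> \<eta> \<omega> - poisson_integrand f1 \<sigma> \<eta> \<omega>)
      (pi * ln (cmod (f2 (Complex \<sigma> \<eta>))) - pi * ln (cmod (f1 (Complex \<sigma> \<eta>))))"
    by (intro has_bochner_integral_diff poisson_log_norm_half_plane an1 an2 bd1 bd2 nz1 nz2 growth1 growth2 \<sigma>)

  \<comment> \<open>Passing from the two factors to their quotient\<close>
  have quot: "ln (cmod (f2 s)) - ln (cmod (f1 s)) = ln (cmod (?m s))"
    if "?m s * E' s = D s" "E' s \<noteq> 0" "D s \<noteq> 0" for s
  proof -
    have "?m s \<noteq> 0" "f2 s = ?m s * f1 s" "f1 s \<noteq> 0"
      using that \<open>C > 0\<close> by (auto simp: f1_def f2_def)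
    then show ?thesis by (simp add: norm_mult ln_mult)
  qed
  let ?z = "Complex \<sigma> \<eta>"
  have z: "?z \<in> rhp" using \<sigma> by (simp add: rhp_def)
  have "ln (cmod (f2 ?z)) - ln (cmod (f1 ?z)) = ln (cmod (?m ?z))"
    using E'_rhp[OF z] gnz[OF z] E'_nz[of ?z] D_nz[of ?z] \<sigma> by (intro quot) auto
  then have val: "pi * ln (cmod (f2 ?z)) - pi * ln (cmod (f1 ?z)) = pi * ln (cmod (?m ?z))"
    by (simp flip: right_diff_distrib)

  \<comment> \<open>The exceptional points form a sparse, hence countable set, so those on the
    imaginary axis do not affect the integral.\<close>
  define S where "S = {s. \<not> (?m s * E' s = D s \<and> E' s \<noteq> 0 \<and> D s \<noteq> 0)}"
  have "\<forall>\<^sub>\<approx>s\<in>UNIV. ?m s * E' s = D s \<and> E' s \<noteq> 0 \<and> D s \<noteq> 0"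
    unfolding eventually_cosparse_open_eq[OF open_UNIV] by (intro ballI eventually_mono[OF rel]) blast
  then have "S sparse_in UNIV" by (simp add: eventually_cosparse S_def)
  then have "countable S" using sparse_imp_countable[OF open_UNIV] by simp
  define X where "X = {\<omega>::real. \<i> * of_real \<omega> \<in> S}"
  have "countable ((\<lambda>\<omega>::real. \<i> * of_real \<omega>) ` X)"
    by (rule countable_subset[OF _ \<open>countable S\<close>]) (auto simp: X_def)
  moreover have "inj_on (\<lambda>\<omega>::real. \<i> * complex_of_real \<omega>) X" by (auto simp: inj_on_def)
  ultimately have "countable X" by (rule countable_image_inj_on)
  then have "has_bochner_integral lborel (poisson_integrand ?m \<sigma> \<eta>) c \<longleftrightarrow>
      has_bochner_integral lborel (\<lambda>\<omega>. poisson_integrand f2 \<sigma> \<eta> \<omega> - poisson_integrand f1 \<sigma> \<eta> \<omega>) c" for c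
  proof (rule has_bochner_integral_discrete_difference)
    fix \<omega> assume "\<omega> \<notin> X"
    then have "ln (cmod (f2 (\<i> * of_real \<omega>))) - ln (cmod (f1 (\<i> * of_real \<omega>))) = ln (cmod (?m (\<i> * of_real \<omega>)))"
      by (intro quot) (auto simp: X_def S_def)
    then show "poisson_integrand ?m \<sigma> \<eta> \<omega> = poisson_integrand f2 \<sigma> \<eta> \<omega> - poisson_integrand f1 \<sigma> \<eta> \<omega>"
      by (simp only: poisson_integrand_def left_diff_distrib[symmetric])
  qed auto
  with I show ?thesis by (simp add: val)
qed

theorem theorem3:
  fixes Gp Gc G g gt Gt :: "complex \<Rightarrow> complex" and \<alpha> \<beta> :: "complex list"
  assumes "transfer_function Gp" and "transfer_function Gc"
    and "G = (\<lambda>s. Gc s * Gp s)"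
    and "remove_sings (\<lambda>s. 1 + G s) \<noteq> (\<lambda>_. 0)"
    and "g = sensitivity G"
    and "\<not> g analytic_on rhp"
    and "zero_list g rhp \<alpha>" and "pole_list g rhp \<beta>"
    and "gt = modified_sensitivity G \<alpha> \<beta>"
    and "Gt = modified_open_loop G \<alpha> \<beta>"
  shows "(\<forall>\<sigma> \<eta>. \<sigma> > 0 \<longrightarrow>
            has_bochner_integral lborel (poisson_integrand gt \<sigma> \<eta>)
              (pi * ln (cmod (gt (Complex \<sigma> \<eta>))))) \<and>
         (\<forall>\<sigma> \<eta>. Complex \<sigma> \<eta> \<in> zeros_on Gt rhp \<longrightarrow>
            has_bochner_integral lborel (poisson_integrand gt \<sigma> \<eta>) 0) \<and>
         (\<forall>\<sigma> \<eta>. Complex \<sigma> \<eta> \<in> zeros_on G rhp \<longrightarrow>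
            has_bochner_integral lborel (poisson_integrand gt \<sigma> \<eta>)
              (pi * ln (cmod (gt (Complex \<sigma> \<eta>)))))"
proof -
  obtain P Q :: "complex poly" and t :: real where PQ: "P \<noteq> 0" "t \<ge> 0"
    "G = (\<lambda>s. poly Q s / poly P s * exp (- of_real t * s))"
    using transfer_function_mult[OF assms(2,1)] unfolding assms(3) by blast
  have G: "G meromorphic_on UNIV"
    unfolding assms(3) by (intro meromorphic_intros transfer_function_meromorphic assms(1,2))
  have zeros: "zero_list (sensitivity G) rhp \<alpha>" and poles: "pole_list (sensitivity G) rhp \<beta>"
    using assms(5,7,8) by simp_all
  \<comment> \<open>By the identity theorem on the connected plane, \<open>1 + G\<close> is either
    zero or nonzero away from isolated points; the first case is excluded by assumption.\<close>
  have "(\<forall>\<^sub>\<approx>s\<in>UNIV. 1 + G s = 0) \<or> (\<forall>\<^sub>\<approx>s\<in>UNIV. 1 + G s \<noteq> 0)"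
    by (rule meromorphic_imp_constant_or_avoid) (auto intro!: meromorphic_intros G)
  moreover have "remove_sings (\<lambda>s. 1 + G s) = (\<lambda>_. 0)" if "\<forall>\<^sub>\<approx>s\<in>UNIV. 1 + G s = 0"
    using that by (auto simp: eventually_cosparse_open_eq fun_eq_iff
                    intro!: remove_sings_eqI tendsto_eventually)
  ultimately have nz: "\<forall>\<^sub>F s in at z. 1 + G s \<noteq> 0" for z
    using assms(4) by (auto simp: eventually_cosparse_open_eq)
  have an: "gt analytic_on rhp"
    unfolding assms(9) by (rule modified_sensitivity_analytic[OF G assms(4) zeros poles])
  have a: "has_bochner_integral lborel (poisson_integrand gt \<sigma> \<eta>) (pi * ln (cmod (gt (Complex \<sigma> \<eta>))))"
    if "\<sigma> > 0" for \<sigma> \<eta>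
    unfolding assms(9) using zeros poles an[unfolded assms(9)] that
    by (intro poisson_modified_sensitivity[OF PQ G nz] modified_sensitivity_nonzero[OF G nz zeros poles])
       (auto simp: zero_list_def pole_list_def zeros_on_def poles_on_def)
  \<comment> \<open>Part (b) then follows from (a) because \<open>ln 1 = 0\<close>.\<close>
  have one: "gt z = 1" if z: "z \<in> zeros_on Gt rhp" for z
  proof -
    have "Gt \<midarrow>z\<rightarrow> 0" using z by (simp add: zeros_on_def)
    then have "(\<lambda>s. 1 / (1 + Gt s)) \<midarrow>z\<rightarrow> 1 / (1 + 0)" by (intro tendsto_intros) auto
    then have "sensitivity Gt z = 1" unfolding sensitivity_def by (intro remove_sings_eqI) simp
    then show ?thesis
      using sensitivity_modified_open_loop[OF G, of \<alpha> \<beta>] assms(9,10) by simp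
  qed
  show ?thesis
  proof (intro conjI allI impI)
    fix \<sigma> \<eta> :: real assume z: "Complex \<sigma> \<eta> \<in> zeros_on Gt rhp"
    then have "\<sigma> > 0" by (simp add: zeros_on_def rhp_def)
    from a[OF this, of \<eta>] show "has_bochner_integral lborel (poisson_integrand gt \<sigma> \<eta>) 0"
      using one[OF z] by simp
  next
    \<comment> \<open>Part (c) is (a) at particular points of the half plane.\<close>
    fix \<sigma> \<eta> :: real assume "Complex \<sigma> \<eta> \<in> zeros_on G rhp"
    then have "\<sigma> > 0" by (simp add: zeros_on_def rhp_def)
    then show "has_bochner_integral lborel (poisson_integrand gt \<sigma> \<eta>) (pi * ln (cmod (gt (Complex \<sigma> \<eta>))))"
      by (rule a)
  qed (rule a)
qed

end
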